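(* Let $O$ be a finite set. Let $\mathcal{P}:\mathbf{FinSet}^{\mathrm{op}}\to\mathbf{Set}$ be the functor sending a finite set $A$ to the set of probability measures $P_A$ on $O^A$, and a map $f:A\to B$ to $\mathcal{P}(B)\to\mathcal{P}(A)$, $P_B\mapsto P_A$ with $P_A(\alpha):=\sum_{\beta\in O^B,\ \beta f=\alpha}P_B(\beta)$. Equip $\mathbf{FinSet}$ with the bicoverings given by cospans $A\to C\leftarrow B$ of injective maps that are jointly surjective; regard $A,B$ as subsets of $C$, so $A\cup B=C$ and $A\times_C B=A\cap B$. For such a bicovering define $g:\mathcal{P}(A)\times_{\mathcal{P}(A\cap B)}\mathcal{P}(B)\to\mathcal{P}(C)$ by $$g(P_A,P_B)(\gamma)=\frac{P_A(\gamma|_A)\,P_B(\gamma|_B)}{P_{A\cap B}(\gamma|_{A\cap B})}\qquad(\gamma\in O^C),$$ where $P_{A\cap B}$ is the common restriction $P_A|_{A\cap B}=P_B|_{A\cap B}$, and the right-hand side is taken to be $0$ whenever the denominator vanishes. With these definitions, $(\mathcal{P},g)$ is a gleaf.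
   Context: **Morphisms of bicoverings.** The cospans named in the claim form a system of bicoverings on $\mathbf{FinSet}$ (the category of finite sets); the two legs are not distinguished. A morphism of bicoverings from $a'\to c'\leftarrow b'$ to $a\to c\leftarrow b$ consists of $q_a:a'\to a$, $q_b:b'\to b$, $q_c:c'\to c$ commuting with the legs, such that the induced map $a'\times_{c'}b'\to a\times_c b$ has a right inverse. **Gleaves.** A $\mathbf{Set}$-valued gleaf on a category $\mathsf{C}$ with a system of bicoverings is a functor $\Gamma:\mathsf{C}^{\mathrm{op}}\to\mathbf{Set}$ together with a map $g:\Gamma(a)\times_{\Gamma(a\times_c b)}\Gamma(b)\to\Gamma(c)$ for every bicovering $a\to c\leftarrow b$ (independent, up to swapping arguments, of the order of the legs), such that: 1. (Identity) for a bicovering $a=a\leftarrow b$, $g=\pi_1:\Gamma(a)\times_{\Gamma(b)}\Gamma(b)\to\Gamma(a)$; for a bicovering $a\to b=b$, $g=\pi_2:\Gamma(a)\times_{\Gamma(a)}\Gamma(b)\to\Gamma(b)$. 2. (Back-and-forth) given bicoverings $a\to c\leftarrow b$ and $a'\to a\leftarrow a\times_c b$, the composite $\Gamma(a')\times_{\Gamma(a'\times_c b)}\Gamma(b)\xrightarrow{g}\Gamma(c)\to\Gamma(a)\times_{\Gamma(a\times_c b)}\Gamma(b)\xrightarrow{g}\Gamma(c)$ (middle arrow: restriction) equals $g:\Gamma(a')\times_{\Gamma(a'\times_c b)}\Gamma(b)\to\Gamma(c)$ (for the composed bicovering $a'\to c\leftarrow b$). 3. (Partial naturality) for every morphism of bicoverings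 $(q_a,q_b,q_c)$ from $a'\to c'\leftarrow b'$ to $a\to c\leftarrow b$, $\Gamma(q_c)\circ g=g\circ(\Gamma(q_a)\times\Gamma(q_b))$ as maps $\Gamma(a)\times_{\Gamma(a\times_c b)}\Gamma(b)\to\Gamma(c')$. *)

theory Defs
  imports "HOL-Probability.Probability"
begin

section \<open>Categories, pullbacks and presheaves\<close>

record ('o, 'm) cat =
  Obj :: "'o set"
  Arr :: "'m set"
  Dom :: "'m \<Rightarrow> 'o"
  Cod :: "'m \<Rightarrow> 'o"
  Ident :: "'o \<Rightarrow> 'm"
  Comp :: "'m \<Rightarrow> 'm \<Rightarrow> 'm"

definition Hom :: "('o, 'm) cat \<Rightarrow> 'o \<Rightarrow> 'o \<Rightarrow> 'm set" where
  "Hom C a b = {f \<in> Arr C. Dom C f = a \<and> Cod C f = b}"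

locale category =
  fixes C :: "('o, 'm) cat"
  assumes Dom_Obj: "f \<in> Arr C \<Longrightarrow> Dom C f \<in> Obj C"
    and Cod_Obj: "f \<in> Arr C \<Longrightarrow> Cod C f \<in> Obj C"
    and Ident_Hom: "a \<in> Obj C \<Longrightarrow> Ident C a \<in> Hom C a a"
    and Comp_Hom: "f \<in> Hom C a b \<Longrightarrow> h \<in> Hom C b c \<Longrightarrow> Comp C h f \<in> Hom C a c"
    and Comp_Ident_left: "f \<in> Hom C a b \<Longrightarrow> Comp C (Ident C b) f = f"
    and Comp_Ident_right: "f \<in> Hom C a b \<Longrightarrow> Comp C f (Ident C a) = f"
    and Comp_assoc: "f \<in> Hom C a b \<Longrightarrow> h \<in> Hom C b c \<Longrightarrow> k \<in> Hom C c d \<Longrightarrow>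
      Comp C k (Comp C h f) = Comp C (Comp C k h) f"

definition is_pullback :: "('o, 'm) cat \<Rightarrow> 'm \<Rightarrow> 'm \<Rightarrow> 'm \<Rightarrow> 'm \<Rightarrow> bool" where
  "is_pullback C f h p\<^sub>1 p\<^sub>2 \<longleftrightarrow>
     f \<in> Arr C \<and> h \<in> Arr C \<and> Cod C f = Cod C h \<and>
     p\<^sub>1 \<in> Hom C (Dom C p\<^sub>1) (Dom C f) \<and> p\<^sub>2 \<in> Hom C (Dom C p\<^sub>1) (Dom C h) \<and>
     Comp C f p\<^sub>1 = Comp C h p\<^sub>2 \<and>
     (\<forall>t \<in> Obj C. \<forall>x\<^sub>1 \<in> Hom C t (Dom C f). \<forall>x\<^sub>2 \<in> Hom C t (Dom C h).
        Comp C f x\<^sub>1 = Comp C h x\<^sub>2 \<longrightarrow>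
        (\<exists>!u. u \<in> Hom C t (Dom C p\<^sub>1) \<and> Comp C p\<^sub>1 u = x\<^sub>1 \<and> Comp C p\<^sub>2 u = x\<^sub>2))"

locale presheaf = category C for C :: "('o, 'm) cat" +
  fixes \<Gamma> :: "'o \<Rightarrow> 'x set"
    and \<Gamma>map :: "'m \<Rightarrow> 'x \<Rightarrow> 'x"
  assumes map_in: "f \<in> Hom C a b \<Longrightarrow> x \<in> \<Gamma> b \<Longrightarrow> \<Gamma>map f x \<in> \<Gamma> a"
    and map_Ident: "a \<in> Obj C \<Longrightarrow> x \<in> \<Gamma> a \<Longrightarrow> \<Gamma>map (Ident C a) x = x"
    and map_Comp: "f \<in> Hom C a b \<Longrightarrow> h \<in> Hom C b c \<Longrightarrow> x \<in> \<Gamma> c \<Longrightarrow>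
      \<Gamma>map (Comp C h f) x = \<Gamma>map f (\<Gamma>map h x)"

section \<open>Bicoverings and gleaves\<close>

text \<open>
  A bicovering is represented by the pair of its legs. Since the legs are not distinguished, the
  set of pairs is closed under swapping; the last axiom provides the composed bicovering that
  the back-and-forth condition of a gleaf refers to.
\<close>

locale bicovering_system = category C for C :: "('o, 'm) cat" +
  fixes Cov :: "('m \<times> 'm) set"
  assumes cov_cospan: "(f, h) \<in> Cov \<Longrightarrow> f \<in> Arr C \<and> h \<in> Arr C \<and> Cod C f = Cod C h"
    and cov_swap: "(f, h) \<in> Cov \<Longrightarrow> (h, f) \<in> Cov"
    and cov_pullback: "(f, h) \<in> Cov \<Longrightarrow> \<exists>p\<^sub>1 p\<^sub>2. is_pullback C f h p\<^sub>1 p\<^sub>2"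
    and cov_comp: "(f, h) \<in> Cov \<Longrightarrow> is_pullback C f h p\<^sub>1 p\<^sub>2 \<Longrightarrow> (k, p\<^sub>1) \<in> Cov \<Longrightarrow>
      (Comp C f k, h) \<in> Cov"

text \<open>
  Pullbacks are unique up to isomorphism, so it does not matter which pullbacks witness
  that the induced map \<open>u\<close> has a right inverse \<open>s\<close>.
\<close>

definition bicovering_morphism ::
    "('o, 'm) cat \<Rightarrow> 'm \<times> 'm \<Rightarrow> 'm \<times> 'm \<Rightarrow> 'm \<Rightarrow> 'm \<Rightarrow> 'm \<Rightarrow> bool" where
  "bicovering_morphism C = (\<lambda>(f', h') (f, h) q\<^sub>a q\<^sub>b q\<^sub>c.
     q\<^sub>a \<in> Hom C (Dom C f') (Dom C f) \<and>
     q\<^sub>b \<in> Hom C (Dom C h') (Dom C h) \<and>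
     q\<^sub>c \<in> Hom C (Cod C f') (Cod C f) \<and>
     Comp C f q\<^sub>a = Comp C q\<^sub>c f' \<and> Comp C h q\<^sub>b = Comp C q\<^sub>c h' \<and>
     (\<exists>p\<^sub>1' p\<^sub>2' p\<^sub>1 p\<^sub>2 u s.
        is_pullback C f' h' p\<^sub>1' p\<^sub>2' \<and> is_pullback C f h p\<^sub>1 p\<^sub>2 \<and>
        u \<in> Hom C (Dom C p\<^sub>1') (Dom C p\<^sub>1) \<and>
        Comp C p\<^sub>1 u = Comp C q\<^sub>a p\<^sub>1' \<and> Comp C p\<^sub>2 u = Comp C q\<^sub>b p\<^sub>2' \<and>
        s \<in> Hom C (Dom C p\<^sub>1) (Dom C p\<^sub>1') \<and> Comp C u s = Ident C (Dom C p\<^sub>1)))"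

text \<open>
  For projections \<open>p\<^sub>1 : d \<rightarrow> a\<close>, \<open>p\<^sub>2 : d \<rightarrow> b\<close> of a pullback
  this is the set \<open>\<Gamma>(a) \<times>\<^bsub>\<Gamma>(d)\<^esub> \<Gamma>(b)\<close>.
\<close>

definition matching ::
    "('o, 'm) cat \<Rightarrow> ('o \<Rightarrow> 'x set) \<Rightarrow> ('m \<Rightarrow> 'x \<Rightarrow> 'x) \<Rightarrow> 'm \<Rightarrow> 'm \<Rightarrow> ('x \<times> 'x) set" where
  "matching C \<Gamma> \<Gamma>map p\<^sub>1 p\<^sub>2 =
     {(x, y). x \<in> \<Gamma> (Cod C p\<^sub>1) \<and> y \<in> \<Gamma> (Cod C p\<^sub>2) \<and> \<Gamma>map p\<^sub>1 x = \<Gamma>map p\<^sub>2 y}"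

locale gleaf = bicovering_system C Cov + presheaf C \<Gamma> \<Gamma>map
  for C :: "('o, 'm) cat" and Cov :: "('m \<times> 'm) set"
    and \<Gamma> :: "'o \<Rightarrow> 'x set" and \<Gamma>map :: "'m \<Rightarrow> 'x \<Rightarrow> 'x" +
  fixes g :: "'m \<Rightarrow> 'm \<Rightarrow> 'x \<Rightarrow> 'x \<Rightarrow> 'x"
  assumes glue_in:
      "(f, h) \<in> Cov \<Longrightarrow> is_pullback C f h p\<^sub>1 p\<^sub>2 \<Longrightarrow> (x, y) \<in> matching C \<Gamma> \<Gamma>map p\<^sub>1 p\<^sub>2 \<Longrightarrow>
       g f h x y \<in> \<Gamma> (Cod C f)"
    and glue_swap:
      "(f, h) \<in> Cov \<Longrightarrow> is_pullback C f h p\<^sub>1 p\<^sub>2 \<Longrightarrow> (x, y) \<in> matching C \<Gamma> \<Gamma>map p\<^sub>1 p\<^sub>2 \<Longrightarrow>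
       g h f y x = g f h x y"
    and glue_identity_left:
      "a \<in> Obj C \<Longrightarrow> (Ident C a, h) \<in> Cov \<Longrightarrow> is_pullback C (Ident C a) h p\<^sub>1 p\<^sub>2 \<Longrightarrow>
       (x, y) \<in> matching C \<Gamma> \<Gamma>map p\<^sub>1 p\<^sub>2 \<Longrightarrow> g (Ident C a) h x y = x"
    and glue_identity_right:
      "b \<in> Obj C \<Longrightarrow> (f, Ident C b) \<in> Cov \<Longrightarrow> is_pullback C f (Ident C b) p\<^sub>1 p\<^sub>2 \<Longrightarrow>
       (x, y) \<in> matching C \<Gamma> \<Gamma>map p\<^sub>1 p\<^sub>2 \<Longrightarrow> g f (Ident C b) x y = y"
    and back_and_forth:
      "(f, h) \<in> Cov \<Longrightarrow> is_pullback C f h p\<^sub>1 p\<^sub>2 \<Longrightarrow> (k, p\<^sub>1) \<in> Cov \<Longrightarrow>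
       is_pullback C (Comp C f k) h r\<^sub>1 r\<^sub>2 \<Longrightarrow> (x, y) \<in> matching C \<Gamma> \<Gamma>map r\<^sub>1 r\<^sub>2 \<Longrightarrow>
       g f h (\<Gamma>map f (g (Comp C f k) h x y)) (\<Gamma>map h (g (Comp C f k) h x y))
         = g (Comp C f k) h x y"
    and partial_naturality:
      "(f', h') \<in> Cov \<Longrightarrow> (f, h) \<in> Cov \<Longrightarrow>
       bicovering_morphism C (f', h') (f, h) q\<^sub>a q\<^sub>b q\<^sub>c \<Longrightarrow>
       is_pullback C f h p\<^sub>1 p\<^sub>2 \<Longrightarrow> (x, y) \<in> matching C \<Gamma> \<Gamma>map p\<^sub>1 p\<^sub>2 \<Longrightarrow>
       \<Gamma>map q\<^sub>c (g f h x y) = g f' h' (\<Gamma>map q\<^sub>a x) (\<Gamma>map q\<^sub>b y)"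

section \<open>Finite sets\<close>

datatype 'a fun_arrow = Fun_Arrow (src: "'a set") (app: "'a \<Rightarrow> 'a") (tgt: "'a set")

text \<open>
  The objects are the finite subsets of an arbitrary type; for an infinite type such as
  \<^typ>\<open>nat\<close> this category is equivalent to that of all finite sets. Functions
  are taken extensional (undefined off their source) so that equal arrows are equal as terms.
\<close>

definition FinSet :: "('a set, 'a fun_arrow) cat" where
  "FinSet = \<lparr>
     Obj = {A. finite A},
     Arr = {f. finite (src f) \<and> finite (tgt f) \<and> app f \<in> src f \<rightarrow>\<^sub>E tgt f},
     Dom = src,
     Cod = tgt,
     Ident = (\<lambda>A. Fun_Arrow A (\<lambda>x\<in>A. x) A),
     Comp = (\<lambda>h f. Fun_Arrow (src f) (compose (src f) (app h) (app f)) (tgt h)) \<rparr>"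

definition inj_bicoverings :: "('a fun_arrow \<times> 'a fun_arrow) set" where
  "inj_bicoverings = {(f, h). f \<in> Arr FinSet \<and> h \<in> Arr FinSet \<and> tgt f = tgt h \<and>
     inj_on (app f) (src f) \<and> inj_on (app h) (src h) \<and>
     app f ` src f \<union> app h ` src h = tgt f}"

section \<open>Probability measures on finite powers of an outcome set\<close>

definition prob_measures :: "'o set \<Rightarrow> 'a set \<Rightarrow> ('a \<Rightarrow> 'o) measure set" where
  "prob_measures X A = {P. prob_space P \<and> sets P = Pow (A \<rightarrow>\<^sub>E X)}"

definition prob_restrict ::
    "'o set \<Rightarrow> 'a fun_arrow \<Rightarrow> ('a \<Rightarrow> 'o) measure \<Rightarrow> ('a \<Rightarrow> 'o) measure" where
  "prob_restrict X f P = point_measure (src f \<rightarrow>\<^sub>E X)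
     (\<lambda>\<alpha>. ennreal (\<Sum>\<beta> | \<beta> \<in> tgt f \<rightarrow>\<^sub>E X \<and> compose (src f) \<beta> (app f) = \<alpha>. measure P {\<beta>}))"

text \<open>
  For injective \<open>f : A \<rightarrow> C\<close> and \<open>h : B \<rightarrow> C\<close>, identifying
  \<open>A\<close> and \<open>B\<close> with their images in \<open>C\<close>, this is the inclusion of the
  intersection into \<open>A\<close>.
\<close>

definition overlap_incl :: "'a fun_arrow \<Rightarrow> 'a fun_arrow \<Rightarrow> 'a fun_arrow" where
  "overlap_incl f h =
     (let D = app f ` src f \<inter> app h ` src h
      in Fun_Arrow D (\<lambda>z\<in>D. inv_into (src f) (app f) z) (src f))"

text \<open>
  The convention that the quotient is 0 when the denominator vanishes is that of
  division on \<^typ>\<open>real\<close>. On matching pairs the overlap marginal may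
  equivalently be computed from \<open>Q\<close>.
\<close>

definition prob_glue ::
    "'o set \<Rightarrow> 'a fun_arrow \<Rightarrow> 'a fun_arrow \<Rightarrow>
     ('a \<Rightarrow> 'o) measure \<Rightarrow> ('a \<Rightarrow> 'o) measure \<Rightarrow> ('a \<Rightarrow> 'o) measure" where
  "prob_glue X f h P Q = point_measure (tgt f \<rightarrow>\<^sub>E X)
     (\<lambda>\<gamma>. ennreal
        (measure P {compose (src f) \<gamma> (app f)} * measure Q {compose (src h) \<gamma> (app h)} /
         measure (prob_restrict X (overlap_incl f h) P)
           {restrict \<gamma> (app f ` src f \<inter> app h ` src h)}))"

end

theory Submission
  imports Defs
begin

text \<open>
  The glued measure makes the variables of \<open>A\<close> and those of \<open>B\<close> conditionally independent
  given the variables of \<open>A \<inter> B\<close>, and the gleaf axioms reflect properties of conditional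
  independence. All measures live on finite sets, so they are determined by their values at
  single configurations, and restriction along \<open>f\<close> is the push-forward along precomposition
  with \<open>f\<close> (\<open>prob_restrict_eq_distr\<close>). The denominator of the gluing formula at a configuration
  \<open>\<gamma>\<close> on \<open>C\<close> is the measure of the cylinder of those configurations on \<open>A\<close> that agree with
  \<open>\<gamma>\<close> on the overlap (\<open>measure_prob_glue\<close>). Compatible measures give the two cylinders over
  \<open>A\<close> and over \<open>B\<close> the same mass (\<open>compatible_cylinder\<close>); this gives symmetry, and a vanishing
  denominator causes no loss of mass because the point masses in the numerator are then zero too.

  The central fact is partial naturality (\<open>prob_glue_natural\<close>). Fix a configuration \<open>\<gamma>'\<close> on
  \<open>C'\<close>. Because the overlap of \<open>A'\<close> and \<open>B'\<close> maps onto that of \<open>A\<close> and \<open>B\<close>, configurations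
  on \<open>A\<close> and on \<open>B\<close> that pull back to the restrictions of \<open>\<gamma>'\<close> automatically agree on the
  overlap, with values prescribed by \<open>\<gamma>'\<close>. So the configurations on \<open>C\<close> over \<open>\<gamma>'\<close> are exactly
  the independent pairs of such configurations, and the denominator is constant on all of them:
  the sum of quotients factors into the gluing formula for the restricted measures.

  Naturality also determines both marginals of the glued measure. Mapping the bicovering \<open>A \<inter> B \<rightarrow> B = B\<close> to
  \<open>A \<rightarrow> C \<leftarrow> B\<close> and using the identity axiom shows that the glued measure restricts to the
  given measure on \<open>B\<close> (\<open>prob_restrict_prob_glue_snd\<close>); in particular it has total mass 1.
  Mapping \<open>A' \<rightarrow> A \<leftarrow> A \<inter> B\<close> to \<open>A' \<rightarrow> C \<leftarrow> B\<close> computes the other marginal as a glued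
  measure, after which back-and-forth (\<open>prob_glue_back_and_forth\<close>) is a cancellation in a
  quotient.
\<close>

section \<open>Finite sets and their pullbacks\<close>

lemma FinSet_simps [simp]:
  "Obj FinSet = {A. finite A}"
  "Arr FinSet = {f. finite (src f) \<and> finite (tgt f) \<and> app f \<in> src f \<rightarrow>\<^sub>E tgt f}"
  "Dom FinSet = src"
  "Cod FinSet = tgt"
  "Ident FinSet A = Fun_Arrow A (\<lambda>x\<in>A. x) A"
  "Comp FinSet h f = Fun_Arrow (src f) (compose (src f) (app h) (app f)) (tgt h)"
  by (simp_all add: FinSet_def)

lemma in_Hom_FinSet_iff:
  "f \<in> Hom FinSet A B \<longleftrightarrow>
     src f = A \<and> tgt f = B \<and> finite A \<and> finite B \<and> app f \<in> A \<rightarrow>\<^sub>E B"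
  by (auto simp: Hom_def)

lemma compose_in_PiE:
  assumes "f \<in> A \<rightarrow>\<^sub>E B" "g \<in> B \<rightarrow>\<^sub>E C"
  shows "compose A g f \<in> A \<rightarrow>\<^sub>E C"
  using assms by (auto simp: compose_def)

lemma category_FinSet: "category (FinSet :: ('a set, 'a fun_arrow) cat)"
proof
  fix f :: "'a fun_arrow" and A B
  assume f: "f \<in> Hom FinSet A B"
  show "Comp FinSet (Ident FinSet B) f = f"
    using f by (intro fun_arrow.expand)
      (auto simp: in_Hom_FinSet_iff compose_def PiE_def extensional_def fun_eq_iff)
  show "Comp FinSet f (Ident FinSet A) = f"
    using f by (intro fun_arrow.expand)
      (auto simp: in_Hom_FinSet_iff compose_def PiE_def extensional_def fun_eq_iff)
next
  fix f h k :: "'a fun_arrow" and A B C D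
  assume "f \<in> Hom FinSet A B" "h \<in> Hom FinSet B C" "k \<in> Hom FinSet C D"
  then show "Comp FinSet k (Comp FinSet h f) = Comp FinSet (Comp FinSet k h) f"
    by (auto simp: in_Hom_FinSet_iff compose_def fun_eq_iff)
next
  fix f h :: "'a fun_arrow" and A B C
  assume "f \<in> Hom FinSet A B" "h \<in> Hom FinSet B C"
  then show "Comp FinSet h f \<in> Hom FinSet A C"
    using compose_in_PiE[of "app f" A B "app h" C]
    unfolding in_Hom_FinSet_iff FinSet_simps(6) fun_arrow.sel by simp
qed (auto simp: in_Hom_FinSet_iff)

lemma inj_bicoveringsD:
  assumes "(f, h) \<in> inj_bicoverings"
  shows "finite (src f)" "finite (src h)" "finite (tgt f)" "tgt h = tgt f"
    "app f \<in> src f \<rightarrow>\<^sub>E tgt f" "app h \<in> src h \<rightarrow>\<^sub>E tgt f"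
    "inj_on (app f) (src f)" "inj_on (app h) (src h)"
    "app f ` src f \<union> app h ` src h = tgt f"
  using assms by (auto simp: inj_bicoverings_def)

lemma app_Comp_eqD:
  assumes "Comp FinSet f p = Comp FinSet h q" "x \<in> src p"
  shows "app f (app p x) = app h (app q x)"
proof -
  have "src p = src q" "compose (src p) (app f) (app p) = compose (src q) (app h) (app q)"
    using assms(1) unfolding FinSet_simps(6) fun_arrow.inject by - (elim conjE, assumption)+
  then show ?thesis using assms(2) by (metis compose_eq)
qed

lemma pullback_square:
  assumes "is_pullback FinSet f h p\<^sub>1 p\<^sub>2"
  shows "src p\<^sub>2 = src p\<^sub>1" "tgt p\<^sub>1 = src f" "tgt p\<^sub>2 = src h"
    "finite (src p\<^sub>1)" "app p\<^sub>1 \<in> src p\<^sub>1 \<rightarrow>\<^sub>E src f" "app p\<^sub>2 \<in> src p\<^sub>1 \<rightarrow>\<^sub>E src h"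
    "\<And>d. d \<in> src p\<^sub>1 \<Longrightarrow> app f (app p\<^sub>1 d) = app h (app p\<^sub>2 d)"
proof -
  note pb = assms[unfolded is_pullback_def FinSet_simps(3,4)]
  have "p\<^sub>1 \<in> Hom FinSet (src p\<^sub>1) (src f)" "p\<^sub>2 \<in> Hom FinSet (src p\<^sub>1) (src h)"
    and comm: "Comp FinSet f p\<^sub>1 = Comp FinSet h p\<^sub>2"
    using pb by - (elim conjE, assumption)+
  then show "src p\<^sub>2 = src p\<^sub>1" "tgt p\<^sub>1 = src f" "tgt p\<^sub>2 = src h"
    "finite (src p\<^sub>1)" "app p\<^sub>1 \<in> src p\<^sub>1 \<rightarrow>\<^sub>E src f" "app p\<^sub>2 \<in> src p\<^sub>1 \<rightarrow>\<^sub>E src h"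
    by (simp_all add: in_Hom_FinSet_iff)
  show "app f (app p\<^sub>1 d) = app h (app p\<^sub>2 d)" if "d \<in> src p\<^sub>1" for d
    using app_Comp_eqD[OF comm that] .
qed

text \<open>
  A pullback of finite sets is only determined up to bijection, so its elements are not literally
  pairs. Testing the universal property on a one-point set recovers them.
\<close>

lemma pullback_point:
  assumes pb: "is_pullback FinSet f h p\<^sub>1 p\<^sub>2"
    and ab: "a \<in> src f" "b \<in> src h" "app f a = app h b"
  obtains d where "d \<in> src p\<^sub>1" "app p\<^sub>1 d = a" "app p\<^sub>2 d = b"
proof -
  \<comment> \<open>Objects are subsets of the type \<open>'a\<close>; as types are inhabited, it has a one-point subset.\<close>
  define t :: "'a set" where "t = {undefined}"
  define x\<^sub>1 x\<^sub>2 where "x\<^sub>1 = Fun_Arrow t (\<lambda>_\<in>t. a) (src f)"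
    and "x\<^sub>2 = Fun_Arrow t (\<lambda>_\<in>t. b) (src h)"
  have fin: "finite (src f)" "finite (src h)" "tgt f = tgt h"
    using pb by (auto simp: is_pullback_def)
  have x: "x\<^sub>1 \<in> Hom FinSet t (src f)" "x\<^sub>2 \<in> Hom FinSet t (src h)"
    using ab fin by (auto simp: x\<^sub>1_def x\<^sub>2_def in_Hom_FinSet_iff t_def)
  have "Comp FinSet f x\<^sub>1 = Comp FinSet h x\<^sub>2"
    using ab fin by (auto simp: x\<^sub>1_def x\<^sub>2_def compose_def fun_eq_iff)
  moreover have "t \<in> Obj FinSet" by (simp add: t_def)
  ultimately obtain u where u: "u \<in> Hom FinSet t (src p\<^sub>1)"
      "Comp FinSet p\<^sub>1 u = x\<^sub>1" "Comp FinSet p\<^sub>2 u = x\<^sub>2"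
    using pb x unfolding is_pullback_def FinSet_simps(3) by blast
  have t: "undefined \<in> t" and src: "src u = t" using u(1) by (auto simp: t_def in_Hom_FinSet_iff)
  have "compose t (app p\<^sub>1) (app u) = (\<lambda>_\<in>t. a)" "compose t (app p\<^sub>2) (app u) = (\<lambda>_\<in>t. b)"
    using u(2,3) src by (simp_all add: x\<^sub>1_def x\<^sub>2_def)
  from this[THEN fun_cong, of undefined]
  have "app p\<^sub>1 (app u undefined) = a" "app p\<^sub>2 (app u undefined) = b"
    using t by (simp_all add: compose_eq)
  moreover have "app u undefined \<in> src p\<^sub>1"
    using u(1) t by (auto simp: in_Hom_FinSet_iff)
  ultimately show ?thesis using that by blast
qed

lemma pullback_image:
  assumes "is_pullback FinSet f h p\<^sub>1 p\<^sub>2"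
  shows "app p\<^sub>1 ` src p\<^sub>1 = {a \<in> src f. app f a \<in> app h ` src h}"
    and "app p\<^sub>2 ` src p\<^sub>1 = {b \<in> src h. app h b \<in> app f ` src f}"
proof -
  note sq = pullback_square[OF assms]
  have sub: "app p\<^sub>1 d \<in> src f \<and> app p\<^sub>2 d \<in> src h \<and> app f (app p\<^sub>1 d) = app h (app p\<^sub>2 d)"
    if "d \<in> src p\<^sub>1" for d
    using PiE_mem[OF sq(5) that] PiE_mem[OF sq(6) that] sq(7)[OF that] by simp
  show "app p\<^sub>1 ` src p\<^sub>1 = {a \<in> src f. app f a \<in> app h ` src h}"
  proof (rule set_eqI, rule iffI)
    fix a assume "a \<in> {a \<in> src f. app f a \<in> app h ` src h}"
    then obtain b where b: "a \<in> src f" "b \<in> src h" "app f a = app h b" by auto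
    show "a \<in> app p\<^sub>1 ` src p\<^sub>1"
      using pullback_point[OF assms b] by (metis rev_image_eqI)
  next
    fix a assume "a \<in> app p\<^sub>1 ` src p\<^sub>1"
    then show "a \<in> {a \<in> src f. app f a \<in> app h ` src h}"
      by (elim imageE) (simp add: sub)
  qed
  show "app p\<^sub>2 ` src p\<^sub>1 = {b \<in> src h. app h b \<in> app f ` src f}"
  proof (rule set_eqI, rule iffI)
    fix b assume "b \<in> {b \<in> src h. app h b \<in> app f ` src f}"
    then obtain a where a: "a \<in> src f" "b \<in> src h" "app f a = app h b" by force
    show "b \<in> app p\<^sub>2 ` src p\<^sub>1"
      using pullback_point[OF assms a] by (metis rev_image_eqI)
  next
    fix b assume "b \<in> app p\<^sub>2 ` src p\<^sub>1"
    then obtain d where "d \<in> src p\<^sub>1" "b = app p\<^sub>2 d" by (elim imageE)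
    with sub[of d] have "app h b = app f (app p\<^sub>1 d)" "app p\<^sub>1 d \<in> src f" "b \<in> src h"
      by simp_all
    then show "b \<in> {b \<in> src h. app h b \<in> app f ` src f}" by simp
  qed
qed

lemma overlap_incl_simps [simp]:
  "src (overlap_incl f h) = app f ` src f \<inter> app h ` src h"
  "tgt (overlap_incl f h) = src f"
  "c \<in> app f ` src f \<Longrightarrow> c \<in> app h ` src h \<Longrightarrow>
     app (overlap_incl f h) c = inv_into (src f) (app f) c"
  by (simp_all add: overlap_incl_def Let_def)

lemma overlap_incl_in_PiE:
  "app (overlap_incl f h) \<in> (app f ` src f \<inter> app h ` src h) \<rightarrow>\<^sub>E src f"
  by (auto simp: overlap_incl_def Let_def intro: inv_into_into)

text \<open>
  The intersection of the images in the common target is a pullback: a cone is determined by its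
  composite into the target, whose values lie in both images.
\<close>

lemma is_pullback_overlap_incl:
  fixes f h :: "'a fun_arrow"
  assumes "(f, h) \<in> inj_bicoverings"
  shows "is_pullback FinSet f h (overlap_incl f h) (overlap_incl h f)"
proof -
  note fh = inj_bicoveringsD[OF assms]
  let ?D = "app f ` src f \<inter> app h ` src h"
  let ?p = "overlap_incl f h" and ?q = "overlap_incl h f"
  have D: "src ?p = ?D" "src ?q = ?D" by auto
  have p: "?p \<in> Hom FinSet ?D (src f)" and q: "?q \<in> Hom FinSet ?D (src h)"
    using fh(1,2) overlap_incl_in_PiE[of f h] overlap_incl_in_PiE[of h f]
    by (simp_all add: in_Hom_FinSet_iff Int_commute)
  have comm: "Comp FinSet f ?p = Comp FinSet h ?q"
    using fh(4) by (auto simp: compose_def f_inv_into_f)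
  have univ: "\<exists>!u. u \<in> Hom FinSet t ?D \<and> Comp FinSet ?p u = x\<^sub>1 \<and> Comp FinSet ?q u = x\<^sub>2"
    if x: "x\<^sub>1 \<in> Hom FinSet t (src f)" "x\<^sub>2 \<in> Hom FinSet t (src h)"
      "Comp FinSet f x\<^sub>1 = Comp FinSet h x\<^sub>2" for t x\<^sub>1 x\<^sub>2
  proof
    have s: "src x\<^sub>1 = t" "src x\<^sub>2 = t" "tgt x\<^sub>1 = src f" "tgt x\<^sub>2 = src h"
      "app x\<^sub>1 \<in> t \<rightarrow>\<^sub>E src f" "app x\<^sub>2 \<in> t \<rightarrow>\<^sub>E src h" "finite t"
      using x(1,2) by (simp_all add: in_Hom_FinSet_iff)
    have e: "app f (app x\<^sub>1 z) = app h (app x\<^sub>2 z)" if "z \<in> t" for z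
      using app_Comp_eqD[OF x(3)] that s(1) by blast
    have D': "app f (app x\<^sub>1 z) \<in> ?D" if "z \<in> t" for z
      using e[OF that] PiE_mem[OF s(5) that] PiE_mem[OF s(6) that] by (metis IntI imageI)
    let ?u = "Fun_Arrow t (\<lambda>z\<in>t. app f (app x\<^sub>1 z)) ?D"
    have "?u \<in> Hom FinSet t ?D"
      unfolding in_Hom_FinSet_iff using D' s(7) fh(1) by simp
    moreover have "Comp FinSet ?p ?u = x\<^sub>1"
    proof (rule fun_arrow.expand, intro conjI ext)
      show "app (Comp FinSet ?p ?u) z = app x\<^sub>1 z" for z
      proof (cases "z \<in> t")
        case True
        then show ?thesis
          using D'[OF True] PiE_mem[OF s(5) True] fh(7) by (simp add: compose_eq inv_into_f_f)
      next
        case False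
        then show ?thesis using PiE_arb[OF s(5) False] by (simp add: compose_def)
      qed
    qed (use s in simp_all)
    moreover have "Comp FinSet ?q ?u = x\<^sub>2"
    proof (rule fun_arrow.expand, intro conjI ext)
      show "app (Comp FinSet ?q ?u) z = app x\<^sub>2 z" for z
      proof (cases "z \<in> t")
        case True
        then show ?thesis
          using D'[OF True] e[OF True] PiE_mem[OF s(6) True] fh(8)
          by (simp add: compose_eq inv_into_f_f)
      next
        case False
        then show ?thesis using PiE_arb[OF s(6) False] by (simp add: compose_def)
      qed
    qed (use s in simp_all)
    ultimately show "?u \<in> Hom FinSet t ?D \<and> Comp FinSet ?p ?u = x\<^sub>1 \<and> Comp FinSet ?q ?u = x\<^sub>2"
      by blast
    fix u assume u: "u \<in> Hom FinSet t ?D \<and> Comp FinSet ?p u = x\<^sub>1 \<and> Comp FinSet ?q u = x\<^sub>2"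
    then have su: "src u = t" "tgt u = ?D" "app u \<in> t \<rightarrow>\<^sub>E ?D"
      and pu: "Comp FinSet ?p u = x\<^sub>1"
      unfolding in_Hom_FinSet_iff by blast+
    show "u = ?u"
    proof (rule fun_arrow.expand, intro conjI ext)
      show "app u z = app ?u z" for z
      proof (cases "z \<in> t")
        case True
        have "app u z \<in> ?D" using PiE_mem[OF su(3) True] .
        moreover have "app x\<^sub>1 z = app ?p (app u z)"
          unfolding pu[symmetric] using True su(1) by (simp add: compose_eq)
        ultimately show ?thesis using True by (simp add: f_inv_into_f)
      next
        case False
        then show ?thesis using PiE_arb[OF su(3) False] by simp
      qed
    qed (use su in simp_all)
  qed
  have arr: "f \<in> Arr FinSet" "h \<in> Arr FinSet" "tgt f = tgt h"
    using fh by simp_all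
  show ?thesis
    unfolding is_pullback_def FinSet_simps(3,4) D
    by (intro conjI arr p q comm ballI impI univ)
qed

section \<open>Bicoverings by jointly surjective injections\<close>

lemma bicovering_arrows:
  assumes "(f, h) \<in> inj_bicoverings"
  shows "f \<in> Arr FinSet" "h \<in> Arr FinSet"
  using inj_bicoveringsD[OF assms] by simp_all

lemma bicovering_system_FinSet:
  "bicovering_system (FinSet :: ('a set, 'a fun_arrow) cat) inj_bicoverings"
proof -
  interpret category "FinSet :: ('a set, 'a fun_arrow) cat" by (rule category_FinSet)
  show ?thesis
  proof
    fix f h p\<^sub>1 p\<^sub>2 k :: "'a fun_arrow"
    assume cov: "(f, h) \<in> inj_bicoverings" and pb: "is_pullback FinSet f h p\<^sub>1 p\<^sub>2"
      and k: "(k, p\<^sub>1) \<in> inj_bicoverings"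
    note fh = inj_bicoveringsD[OF cov] and kp = inj_bicoveringsD[OF k]
    have tk: "tgt k = src f" using kp(4) pullback_square[OF pb] by simp
    have "app f ` app k ` src k \<union> app h ` src h = tgt f"
    proof -
      have set_eq: "K \<union> H = T" if "P \<subseteq> H" "K \<union> P = A" "A \<union> H = T" for A P K H T :: "'a set"
        using that by blast
      have "app f ` app p\<^sub>1 ` src p\<^sub>1 \<subseteq> app h ` src h"
        unfolding pullback_image(1)[OF pb] by (intro image_subsetI) simp
      moreover have "app k ` src k \<union> app p\<^sub>1 ` src p\<^sub>1 = src f" using kp(9) tk by simp
      then have "app f ` app k ` src k \<union> app f ` app p\<^sub>1 ` src p\<^sub>1 = app f ` src f"
        by (simp only: image_Un[symmetric])
      ultimately show ?thesis using fh(9) by (rule set_eq)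
    qed
    moreover have "compose (src k) (app f) (app k) ` src k = app f ` app k ` src k"
      by (auto simp: compose_def)
    moreover have "inj_on (compose (src k) (app f) (app k)) (src k)"
    proof -
      have "app k ` src k \<subseteq> src f" using kp(9) tk by (metis Un_upper1)
      then have "inj_on (app f \<circ> app k) (src k)"
        using kp(7) fh(7) by (meson comp_inj_on inj_on_subset)
      then show ?thesis by (simp add: compose_def inj_on_def)
    qed
    moreover have "compose (src k) (app f) (app k) \<in> src k \<rightarrow>\<^sub>E tgt f"
      by (rule compose_in_PiE[OF kp(5)[unfolded tk] fh(5)])
    ultimately show "(Comp FinSet f k, h) \<in> inj_bicoverings"
      using fh kp by (simp add: inj_bicoverings_def)
  next
    fix f h :: "'a fun_arrow" assume "(f, h) \<in> inj_bicoverings"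
    then show "\<exists>p\<^sub>1 p\<^sub>2. is_pullback FinSet f h p\<^sub>1 p\<^sub>2"
      using is_pullback_overlap_incl by blast
  qed (auto simp: inj_bicoverings_def)
qed

text \<open>
  The only consequence of the right inverse that naturality uses: each overlap point of the target
  bicovering comes from an overlap point of the source bicovering.
\<close>

lemma bicovering_morphism_overlap:
  assumes "bicovering_morphism FinSet (f', h') (f, h) q\<^sub>a q\<^sub>b q\<^sub>c"
    and a: "a \<in> src f" "app f a \<in> app h ` src h"
  shows "\<exists>a'\<in>src f'. app f' a' \<in> app h' ` src h' \<and> app q\<^sub>a a' = a"
proof -
  obtain p\<^sub>1' p\<^sub>2' p\<^sub>1 p\<^sub>2 u s where pb': "is_pullback FinSet f' h' p\<^sub>1' p\<^sub>2'"
    and pb: "is_pullback FinSet f h p\<^sub>1 p\<^sub>2"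
    and u: "u \<in> Hom FinSet (src p\<^sub>1') (src p\<^sub>1)" and s: "s \<in> Hom FinSet (src p\<^sub>1) (src p\<^sub>1')"
    and comm: "Comp FinSet p\<^sub>1 u = Comp FinSet q\<^sub>a p\<^sub>1'"
    and us: "Comp FinSet u s = Ident FinSet (src p\<^sub>1)"
    using assms(1) unfolding bicovering_morphism_def prod.case FinSet_simps(3,4)
    by (elim conjE exE) (rule that)
  note sq' = pullback_square[OF pb']
  from a have "a \<in> app p\<^sub>1 ` src p\<^sub>1" unfolding pullback_image(1)[OF pb] by simp
  then obtain d where d: "d \<in> src p\<^sub>1" "app p\<^sub>1 d = a" by (elim imageE) simp
  have s': "app s \<in> src p\<^sub>1 \<rightarrow>\<^sub>E src p\<^sub>1'" "src s = src p\<^sub>1" and u': "src u = src p\<^sub>1'"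
    using s u by (simp_all add: in_Hom_FinSet_iff)
  have sd: "app s d \<in> src p\<^sub>1'" by (rule PiE_mem[OF s'(1) d(1)])
  have "compose (src p\<^sub>1) (app u) (app s) = (\<lambda>x\<in>src p\<^sub>1. x)"
    using us s'(2) by simp
  from fun_cong[OF this, of d] have usd: "app u (app s d) = d" using d(1) by (simp add: compose_eq)
  have "app p\<^sub>1 (app u (app s d)) = app q\<^sub>a (app p\<^sub>1' (app s d))"
    by (rule app_Comp_eqD[OF comm]) (simp add: u' sd)
  then have "app q\<^sub>a (app p\<^sub>1' (app s d)) = a" using usd d(2) by simp
  moreover have "app p\<^sub>1' (app s d) \<in> {a' \<in> src f'. app f' a' \<in> app h' ` src h'}"
    unfolding pullback_image(1)[OF pb', symmetric] using sd by simp
  ultimately show ?thesis by blast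
qed

section \<open>Configurations on a bicovering\<close>

abbreviation pull :: "'a fun_arrow \<Rightarrow> ('a \<Rightarrow> 'o) \<Rightarrow> 'a \<Rightarrow> 'o" where
  "pull f \<gamma> \<equiv> compose (src f) \<gamma> (app f)"

lemma pull_in_PiE:
  assumes "app f \<in> src f \<rightarrow>\<^sub>E tgt f" "\<gamma> \<in> tgt f \<rightarrow>\<^sub>E X"
  shows "pull f \<gamma> \<in> src f \<rightarrow>\<^sub>E X"
  by (rule compose_in_PiE[OF assms])

lemma pull_Comp:
  assumes "app k \<in> src k \<rightarrow>\<^sub>E src f"
  shows "pull (Comp FinSet f k) \<gamma> = pull k (pull f \<gamma>)"
proof
  show "pull (Comp FinSet f k) \<gamma> a = pull k (pull f \<gamma>) a" for a
    using PiE_mem[OF assms, of a] by (cases "a \<in> src k") (simp_all add: compose_def)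
qed

lemma pull_Ident:
  assumes "\<gamma> \<in> A \<rightarrow>\<^sub>E X"
  shows "pull (Ident FinSet A) \<gamma> = \<gamma>"
proof
  show "pull (Ident FinSet A) \<gamma> a = \<gamma> a" for a
    using PiE_arb[OF assms, of a] by (cases "a \<in> A") (simp_all add: compose_def)
qed

text \<open>
  The overlap enters through its points rather than through a pullback, so that cylinders can be
  compared across different bicoverings.
\<close>

definition cylinder ::
    "'o set \<Rightarrow> 'a fun_arrow \<Rightarrow> 'a fun_arrow \<Rightarrow> ('a \<Rightarrow> 'o) \<Rightarrow> ('a \<Rightarrow> 'o) set" where
  "cylinder X f h \<gamma> =
     {\<alpha> \<in> src f \<rightarrow>\<^sub>E X. \<forall>a\<in>src f. app f a \<in> app h ` src h \<longrightarrow> \<alpha> a = \<gamma> (app f a)}"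

lemma cylinder_subset: "cylinder X f h \<gamma> \<subseteq> src f \<rightarrow>\<^sub>E X"
  by (simp add: cylinder_def)

lemma pull_in_cylinder:
  assumes "app f \<in> src f \<rightarrow>\<^sub>E tgt f" "\<gamma> \<in> tgt f \<rightarrow>\<^sub>E X"
  shows "pull f \<gamma> \<in> cylinder X f h \<gamma>"
  using pull_in_PiE[OF assms] by (simp add: cylinder_def compose_eq)

lemma pull_eq_pull_iff:
  "pull p \<alpha> = pull p \<beta> \<longleftrightarrow> (\<forall>a\<in>app p ` src p. \<alpha> a = \<beta> a)"
  by (auto simp: compose_def fun_eq_iff)

text \<open>
  Agreement on the overlap is equality of the restrictions to any pullback, since the projection
  reaches precisely the overlap points.
\<close>

lemma cylinder_eq_fst:
  assumes "is_pullback FinSet f h p\<^sub>1 p\<^sub>2"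
  shows "cylinder X f h \<gamma> = {\<alpha> \<in> src f \<rightarrow>\<^sub>E X. pull p\<^sub>1 \<alpha> = pull p\<^sub>1 (pull f \<gamma>)}"
  unfolding pull_eq_pull_iff pullback_image(1)[OF assms] cylinder_def
  by (simp add: compose_eq Ball_def imp_conjL)

lemma cylinder_eq_snd:
  assumes "is_pullback FinSet f h p\<^sub>1 p\<^sub>2"
  shows "cylinder X h f \<gamma> = {\<beta> \<in> src h \<rightarrow>\<^sub>E X. pull p\<^sub>2 \<beta> = pull p\<^sub>2 (pull h \<gamma>)}"
proof -
  have "app p\<^sub>2 ` src p\<^sub>2 = {b \<in> src h. app h b \<in> app f ` src f}"
    using pullback_image(2)[OF assms] pullback_square(1)[OF assms] by simp
  then show ?thesis
    unfolding pull_eq_pull_iff cylinder_def by (simp add: compose_eq Ball_def imp_conjL)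
qed

lemma pull_square:
  assumes "is_pullback FinSet f h p\<^sub>1 p\<^sub>2"
  shows "pull p\<^sub>1 (pull f \<gamma>) = pull p\<^sub>2 (pull h \<gamma>)"
proof
  note sq = pullback_square[OF assms]
  show "pull p\<^sub>1 (pull f \<gamma>) d = pull p\<^sub>2 (pull h \<gamma>) d" for d
    using PiE_mem[OF sq(5), of d] PiE_mem[OF sq(6), of d] sq(7)[of d] sq(1)
    by (cases "d \<in> src p\<^sub>1") (simp_all add: compose_def)
qed

lemma bicovering_config_eqI:
  assumes cov: "(f, h) \<in> inj_bicoverings"
    and \<gamma>: "\<gamma> \<in> tgt f \<rightarrow>\<^sub>E X" "\<gamma>' \<in> tgt f \<rightarrow>\<^sub>E X"
    and eq: "pull f \<gamma> = pull f \<gamma>'" "pull h \<gamma> = pull h \<gamma>'"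
  shows "\<gamma> = \<gamma>'"
proof (rule PiE_ext[OF \<gamma>])
  fix c assume "c \<in> tgt f"
  then have "c \<in> app f ` src f \<union> app h ` src h" using inj_bicoveringsD(9)[OF cov] by simp
  then show "\<gamma> c = \<gamma>' c" using eq unfolding pull_eq_pull_iff by blast
qed

text \<open>
  Together with uniqueness in \<open>bicovering_config_eqI\<close> this is the sheaf property of configurations
  for bicoverings.
\<close>

lemma amalgamate_configs:
  assumes cov: "(f, h) \<in> inj_bicoverings"
    and \<alpha>: "\<alpha> \<in> src f \<rightarrow>\<^sub>E X" and \<beta>: "\<beta> \<in> src h \<rightarrow>\<^sub>E X"
    and agree: "\<forall>a\<in>src f. \<forall>b\<in>src h. app f a = app h b \<longrightarrow> \<alpha> a = \<beta> b"
  obtains \<gamma> where "\<gamma> \<in> tgt f \<rightarrow>\<^sub>E X" "pull f \<gamma> = \<alpha>" "pull h \<gamma> = \<beta>"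
proof
  note fh = inj_bicoveringsD[OF cov]
  define \<gamma> where "\<gamma> = (\<lambda>c\<in>tgt f. if c \<in> app f ` src f
    then \<alpha> (inv_into (src f) (app f) c) else \<beta> (inv_into (src h) (app h) c))"
  have f: "\<gamma> (app f a) = \<alpha> a" if "a \<in> src f" for a
    using that PiE_mem[OF fh(5) that] fh(7) by (simp add: \<gamma>_def inv_into_f_f)
  have h: "\<gamma> (app h b) = \<beta> b" if "b \<in> src h" for b
  proof (cases "app h b \<in> app f ` src f")
    case True
    then obtain a where "a \<in> src f" "app f a = app h b" by (metis imageE)
    then show ?thesis using f[of a] agree that by simp
  next
    case False
    then show ?thesis
      using that PiE_mem[OF fh(6) that] fh(8) by (simp add: \<gamma>_def inv_into_f_f)
  qed
  show "\<gamma> \<in> tgt f \<rightarrow>\<^sub>E X"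
  proof (rule PiE_I)
    fix c assume "c \<in> tgt f"
    then have "c \<in> app f ` src f \<or> c \<in> app h ` src h" using fh(9) by blast
    then show "\<gamma> c \<in> X"
      using f h PiE_mem[OF \<alpha>] PiE_mem[OF \<beta>] by (elim disjE imageE) simp_all
  qed (simp add: \<gamma>_def)
  show "pull f \<gamma> = \<alpha>"
  proof
    show "pull f \<gamma> a = \<alpha> a" for a
      using f[of a] PiE_arb[OF \<alpha>, of a] by (cases "a \<in> src f") (simp_all add: compose_def)
  qed
  show "pull h \<gamma> = \<beta>"
  proof
    show "pull h \<gamma> b = \<beta> b" for b
      using h[of b] PiE_arb[OF \<beta>, of b] by (cases "b \<in> src h") (simp_all add: compose_def)
  qed
qed

section \<open>Measures on configurations and their marginals\<close>

text \<open>
  Total mass is left arbitrary here because that of a glued measure is known only once its marginals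
  have been computed, and these computations already rely on the lemmas on restriction.
\<close>

definition config_measures :: "'o set \<Rightarrow> 'a set \<Rightarrow> ('a \<Rightarrow> 'o) measure set" where
  "config_measures X A = {P. finite_measure P \<and> sets P = Pow (A \<rightarrow>\<^sub>E X)}"

lemma prob_measures_subset: "prob_measures X A \<subseteq> config_measures X A"
  by (auto simp: prob_measures_def config_measures_def intro: prob_space.finite_measure)

lemma space_config_measure: "P \<in> config_measures X A \<Longrightarrow> space P = A \<rightarrow>\<^sub>E X"
  using sets_eq_imp_space_eq[of P "count_space (A \<rightarrow>\<^sub>E X)"] by (simp add: config_measures_def)

text \<open>
  Matching over the canonical overlap, freed from an arbitrary choice of pullback.
\<close>

definition compatible ::
    "'o set \<Rightarrow> 'a fun_arrow \<Rightarrow> 'a fun_arrow \<Rightarrow>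
     ('a \<Rightarrow> 'o) measure \<Rightarrow> ('a \<Rightarrow> 'o) measure \<Rightarrow> bool" where
  "compatible X f h P Q \<longleftrightarrow>
     prob_restrict X (overlap_incl f h) P = prob_restrict X (overlap_incl h f) Q"

context
  fixes X :: "'o set"
  assumes fin_X: "finite X"
begin

lemma finite_configs: "finite A \<Longrightarrow> finite (A \<rightarrow>\<^sub>E X)"
  using fin_X by (simp add: finite_PiE)

lemma measure_config_eq_sum:
  assumes "P \<in> config_measures X A" "finite A" "S \<subseteq> A \<rightarrow>\<^sub>E X"
  shows "measure P S = (\<Sum>\<gamma>\<in>S. measure P {\<gamma>})"
proof -
  interpret finite_measure P using assms(1) by (simp add: config_measures_def)
  show ?thesis
    using assms finite_subset[OF assms(3) finite_configs[OF assms(2)]]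
    by (intro finite_measure_eq_sum_singleton) (auto simp: config_measures_def)
qed

lemma config_measure_eqI:
  assumes "P \<in> config_measures X A" "Q \<in> config_measures X A" "finite A"
    and "\<And>\<gamma>. \<gamma> \<in> A \<rightarrow>\<^sub>E X \<Longrightarrow> measure P {\<gamma>} = measure Q {\<gamma>}"
  shows "P = Q"
proof (rule measure_eqI_finite)
  interpret P: finite_measure P using assms(1) by (simp add: config_measures_def)
  interpret Q: finite_measure Q using assms(2) by (simp add: config_measures_def)
  show "sets P = Pow (A \<rightarrow>\<^sub>E X)" "sets Q = Pow (A \<rightarrow>\<^sub>E X)" "finite (A \<rightarrow>\<^sub>E X)"
    using assms finite_configs by (simp_all add: config_measures_def)
  show "emeasure P {\<gamma>} = emeasure Q {\<gamma>}" if "\<gamma> \<in> A \<rightarrow>\<^sub>E X" for \<gamma>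
    using assms(4)[OF that] by (simp add: P.emeasure_eq_measure Q.emeasure_eq_measure)
qed

lemma measure_config_zero_mono:
  assumes "P \<in> config_measures X A" "S \<subseteq> A \<rightarrow>\<^sub>E X" "measure P S = 0" "\<gamma> \<in> S"
  shows "measure P {\<gamma>} = 0"
proof -
  interpret finite_measure P using assms(1) by (simp add: config_measures_def)
  have "measure P {\<gamma>} \<le> measure P S"
    using assms by (intro finite_measure_mono) (auto simp: config_measures_def)
  then show ?thesis using assms(3) by (simp add: measure_le_0_iff)
qed

lemma point_measure_config:
  assumes "finite A"
  shows "point_measure (A \<rightarrow>\<^sub>E X) (\<lambda>\<gamma>. ennreal (p \<gamma>)) \<in> config_measures X A"
  using finite_configs[OF assms]
  by (auto simp: config_measures_def sets_point_measure space_point_measure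
      emeasure_point_measure_finite intro!: finite_measureI)

lemma measure_point_measure_config:
  assumes "finite A" "\<gamma> \<in> A \<rightarrow>\<^sub>E X" "p \<gamma> \<ge> 0"
  shows "measure (point_measure (A \<rightarrow>\<^sub>E X) (\<lambda>\<gamma>. ennreal (p \<gamma>))) {\<gamma>} = p \<gamma>"
  using finite_configs[OF assms(1)] assms(2,3)
  by (simp add: Sigma_Algebra.measure_def emeasure_point_measure_finite)

lemma pull_measurable:
  assumes "app f \<in> src f \<rightarrow>\<^sub>E tgt f" "P \<in> config_measures X (tgt f)"
  shows "pull f \<in> measurable P (count_space (src f \<rightarrow>\<^sub>E X))"
proof -
  have "sets P = sets (count_space (tgt f \<rightarrow>\<^sub>E X))" using assms(2) by (simp add: config_measures_def)
  then show ?thesis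
    unfolding measurable_cong_sets[OF \<open>sets P = _\<close> refl] measurable_count_space_eq1 space_count_space
    by (intro Pi_I pull_in_PiE[OF assms(1)])
qed

lemma prob_restrict_config:
  assumes "finite (src f)"
  shows "prob_restrict X f P \<in> config_measures X (src f)"
  unfolding prob_restrict_def by (rule point_measure_config[OF assms])

text \<open>
  As a push-forward along precomposition, restriction is contravariantly functorial and can be
  evaluated on arbitrary sets of configurations, not only at points.
\<close>

lemma prob_restrict_eq_distr:
  assumes f: "f \<in> Arr FinSet" and P: "P \<in> config_measures X (tgt f)"
  shows "prob_restrict X f P = distr P (count_space (src f \<rightarrow>\<^sub>E X)) (pull f)"
proof -
  have f': "finite (src f)" "finite (tgt f)" "app f \<in> src f \<rightarrow>\<^sub>E tgt f" using f by simp_all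
  note meas = pull_measurable[OF f'(3) P]
  interpret finite_measure P using P by (simp add: config_measures_def)
  show ?thesis
  proof (rule config_measure_eqI[OF _ _ f'(1)])
    show "prob_restrict X f P \<in> config_measures X (src f)"
      by (rule prob_restrict_config[OF f'(1)])
    show "distr P (count_space (src f \<rightarrow>\<^sub>E X)) (pull f) \<in> config_measures X (src f)"
      using finite_measure_distr[OF meas] by (simp add: config_measures_def)
    fix \<alpha> assume \<alpha>: "\<alpha> \<in> src f \<rightarrow>\<^sub>E X"
    have "measure (prob_restrict X f P) {\<alpha>}
        = (\<Sum>\<beta> | \<beta> \<in> tgt f \<rightarrow>\<^sub>E X \<and> pull f \<beta> = \<alpha>. measure P {\<beta>})"
      unfolding prob_restrict_def
      by (rule measure_point_measure_config[OF f'(1) \<alpha>]) (simp add: sum_nonneg)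
    also have "\<dots> = measure P {\<beta> \<in> tgt f \<rightarrow>\<^sub>E X. pull f \<beta> = \<alpha>}"
      by (rule measure_config_eq_sum[OF P f'(2), symmetric]) blast
    also have "{\<beta> \<in> tgt f \<rightarrow>\<^sub>E X. pull f \<beta> = \<alpha>} = pull f -` {\<alpha>} \<inter> space P"
      unfolding space_config_measure[OF P] by (simp add: set_eq_iff conj_commute)
    also have "measure P \<dots> = measure (distr P (count_space (src f \<rightarrow>\<^sub>E X)) (pull f)) {\<alpha>}"
      by (rule measure_distr[OF meas, symmetric]) (use \<alpha> in simp)
    finally show "measure (prob_restrict X f P) {\<alpha>}
        = measure (distr P (count_space (src f \<rightarrow>\<^sub>E X)) (pull f)) {\<alpha>}" .
  qed
qed

lemma measure_prob_restrict:
  assumes f: "f \<in> Arr FinSet" and P: "P \<in> config_measures X (tgt f)" and S: "S \<subseteq> src f \<rightarrow>\<^sub>E X"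
  shows "measure (prob_restrict X f P) S = measure P {\<gamma> \<in> tgt f \<rightarrow>\<^sub>E X. pull f \<gamma> \<in> S}"
proof -
  have meas: "pull f \<in> measurable P (count_space (src f \<rightarrow>\<^sub>E X))"
    using f P by (intro pull_measurable) simp_all
  have "{\<gamma> \<in> tgt f \<rightarrow>\<^sub>E X. pull f \<gamma> \<in> S} = pull f -` S \<inter> space P"
    unfolding space_config_measure[OF P] by (simp add: set_eq_iff conj_commute)
  then show ?thesis
    unfolding prob_restrict_eq_distr[OF f P] using measure_distr[OF meas] S by simp
qed

text \<open>
  Push-forward preserves total mass. The direction from left to right is used to see that a glued
  measure is a probability measure, by restricting it to one of the legs.
\<close>

lemma prob_restrict_prob_iff:
  assumes f: "f \<in> Arr FinSet" and P: "P \<in> config_measures X (tgt f)"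
  shows "prob_restrict X f P \<in> prob_measures X (src f) \<longleftrightarrow> P \<in> prob_measures X (tgt f)"
proof -
  have meas: "pull f \<in> measurable P (count_space (src f \<rightarrow>\<^sub>E X))"
    using f P by (intro pull_measurable) simp_all
  show ?thesis
    using prob_space_distrD[OF meas] prob_space.prob_space_distr[OF _ meas] P
    unfolding prob_restrict_eq_distr[OF f P]
    by (auto simp: prob_measures_def config_measures_def)
qed

lemma prob_restrict_Ident:
  assumes "finite A" and P: "P \<in> config_measures X A"
  shows "prob_restrict X (Ident FinSet A) P = P"
proof (rule config_measure_eqI[OF _ P assms(1)])
  let ?i = "Ident FinSet A :: 'a fun_arrow"
  have i: "src ?i = A" "tgt ?i = A" "?i \<in> Arr FinSet" using assms(1) by simp_all
  show "prob_restrict X ?i P \<in> config_measures X A"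
    using prob_restrict_config[of ?i P] assms(1) by simp
  fix \<gamma> assume \<gamma>: "\<gamma> \<in> A \<rightarrow>\<^sub>E X"
  have "measure (prob_restrict X ?i P) {\<gamma>} = measure P {\<gamma>' \<in> A \<rightarrow>\<^sub>E X. pull ?i \<gamma>' \<in> {\<gamma>}}"
    using measure_prob_restrict[OF i(3), of P "{\<gamma>}"] P \<gamma> unfolding i by blast
  also have "{\<gamma>' \<in> A \<rightarrow>\<^sub>E X. pull ?i \<gamma>' \<in> {\<gamma>}} = {\<gamma>}"
  proof (rule set_eqI)
    show "\<gamma>' \<in> {\<gamma>' \<in> A \<rightarrow>\<^sub>E X. pull ?i \<gamma>' \<in> {\<gamma>}} \<longleftrightarrow> \<gamma>' \<in> {\<gamma>}" for \<gamma>'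
      using pull_Ident[of \<gamma>' A X] \<gamma> by (metis (mono_tags, lifting) mem_Collect_eq singleton_iff)
  qed
  finally show "measure (prob_restrict X ?i P) {\<gamma>} = measure P {\<gamma>}" .
qed

lemma prob_restrict_Comp:
  assumes f: "f \<in> Hom FinSet A B" and h: "h \<in> Hom FinSet B C"
    and P: "P \<in> config_measures X C"
  shows "prob_restrict X (Comp FinSet h f) P = prob_restrict X f (prob_restrict X h P)"
proof -
  have f': "src f = A" "tgt f = B" "f \<in> Arr FinSet" "finite A" "app f \<in> src f \<rightarrow>\<^sub>E tgt f"
    and h': "src h = B" "tgt h = C" "h \<in> Arr FinSet" "finite B" "app h \<in> src h \<rightarrow>\<^sub>E tgt h"
    using f h by (simp_all add: in_Hom_FinSet_iff)
  have "Comp FinSet h f \<in> Hom FinSet A C"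
    using category.Comp_Hom[OF category_FinSet f h] .
  then have hf: "src (Comp FinSet h f) = A" "tgt (Comp FinSet h f) = C" "Comp FinSet h f \<in> Arr FinSet"
    by (simp_all only: Hom_def mem_Collect_eq FinSet_simps(3,4))
  have Q: "prob_restrict X h P \<in> config_measures X B"
    using prob_restrict_config[of h P] h' by simp
  show ?thesis
  proof (rule config_measure_eqI[OF _ _ f'(4)])
    show "prob_restrict X (Comp FinSet h f) P \<in> config_measures X A"
      using prob_restrict_config[of "Comp FinSet h f" P] hf(1) f'(4) by metis
    show "prob_restrict X f (prob_restrict X h P) \<in> config_measures X A"
      using prob_restrict_config[of f "prob_restrict X h P"] f' by metis
    fix \<alpha> assume \<alpha>: "\<alpha> \<in> A \<rightarrow>\<^sub>E X"
    have "measure (prob_restrict X f (prob_restrict X h P)) {\<alpha>}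
        = measure (prob_restrict X h P) {\<beta> \<in> B \<rightarrow>\<^sub>E X. pull f \<beta> = \<alpha>}"
      using measure_prob_restrict[OF f'(3), of "prob_restrict X h P" "{\<alpha>}"] Q \<alpha>
      unfolding f'(1,2) by simp
    also have "\<dots> = measure P {\<gamma> \<in> C \<rightarrow>\<^sub>E X. pull h \<gamma> \<in> {\<beta> \<in> B \<rightarrow>\<^sub>E X. pull f \<beta> = \<alpha>}}"
      using measure_prob_restrict[OF h'(3), of P "{\<beta> \<in> B \<rightarrow>\<^sub>E X. pull f \<beta> = \<alpha>}"] P
      unfolding h'(1,2) by blast
    also have "{\<gamma> \<in> C \<rightarrow>\<^sub>E X. pull h \<gamma> \<in> {\<beta> \<in> B \<rightarrow>\<^sub>E X. pull f \<beta> = \<alpha>}}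
        = {\<gamma> \<in> C \<rightarrow>\<^sub>E X. pull (Comp FinSet h f) \<gamma> \<in> {\<alpha>}}"
    proof (rule Collect_cong, rule conj_cong[OF refl])
      fix \<gamma> assume "\<gamma> \<in> C \<rightarrow>\<^sub>E X"
      then have "pull h \<gamma> \<in> B \<rightarrow>\<^sub>E X" using pull_in_PiE[OF h'(5), of \<gamma> X] h' by simp
      moreover have "pull (Comp FinSet h f) \<gamma> = pull f (pull h \<gamma>)"
        using f'(5) unfolding f'(2) h'(1)[symmetric] by (rule pull_Comp)
      ultimately show "(pull h \<gamma> \<in> {\<beta> \<in> B \<rightarrow>\<^sub>E X. pull f \<beta> = \<alpha>})
          = (pull (Comp FinSet h f) \<gamma> \<in> {\<alpha>})" by (simp only: mem_Collect_eq singleton_iff simp_thms)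
    qed
    also have "measure P \<dots> = measure (prob_restrict X (Comp FinSet h f) P) {\<alpha>}"
      using measure_prob_restrict[OF hf(3), of P "{\<alpha>}"] P \<alpha> unfolding hf(1,2) by simp
    finally show "measure (prob_restrict X (Comp FinSet h f) P) {\<alpha>}
        = measure (prob_restrict X f (prob_restrict X h P)) {\<alpha>}" ..
  qed
qed

lemma presheaf_prob_measures:
  "presheaf (FinSet :: ('a set, 'a fun_arrow) cat) (prob_measures X) (prob_restrict X)"
proof -
  interpret category "FinSet :: ('a set, 'a fun_arrow) cat" by (rule category_FinSet)
  show ?thesis
  proof
    fix f :: "'a fun_arrow" and A B and P :: "('a \<Rightarrow> 'o) measure"
    assume f: "f \<in> Hom FinSet A B" and P: "P \<in> prob_measures X B"
    then have "src f = A" "tgt f = B" "f \<in> Arr FinSet" by (simp_all add: in_Hom_FinSet_iff)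
    then show "prob_restrict X f P \<in> prob_measures X A"
      using prob_restrict_prob_iff[of f P] P prob_measures_subset[of X B] by blast
  next
    fix A and P :: "('a \<Rightarrow> 'o) measure"
    assume "A \<in> Obj FinSet" "P \<in> prob_measures X A"
    then show "prob_restrict X (Ident FinSet A) P = P"
      using prob_restrict_Ident[of A P] prob_measures_subset[of X A] by auto
  next
    fix f h :: "'a fun_arrow" and A B C and P :: "('a \<Rightarrow> 'o) measure"
    assume "f \<in> Hom FinSet A B" "h \<in> Hom FinSet B C" "P \<in> prob_measures X C"
    then show "prob_restrict X (Comp FinSet h f) P = prob_restrict X f (prob_restrict X h P)"
      using prob_restrict_Comp prob_measures_subset[of X C] by blast
  qed
qed

section \<open>Compatible pairs of measures\<close>

lemma measure_prob_restrict_pullback: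
  assumes "is_pullback FinSet f h p\<^sub>1 p\<^sub>2" "h \<in> Arr FinSet"
    and "f \<in> Arr FinSet" "P \<in> config_measures X (src f)" "\<gamma> \<in> tgt f \<rightarrow>\<^sub>E X"
  shows "measure (prob_restrict X p\<^sub>1 P) {pull p\<^sub>1 (pull f \<gamma>)} = measure P (cylinder X f h \<gamma>)"
proof -
  note sq = pullback_square[OF assms(1)]
  have f: "app f \<in> src f \<rightarrow>\<^sub>E tgt f" "finite (src f)" using assms(3) by simp_all
  have p: "p\<^sub>1 \<in> Arr FinSet" "app p\<^sub>1 \<in> src p\<^sub>1 \<rightarrow>\<^sub>E tgt p\<^sub>1" using sq f by simp_all
  have "pull p\<^sub>1 (pull f \<gamma>) \<in> src p\<^sub>1 \<rightarrow>\<^sub>E X"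
    by (rule pull_in_PiE[OF p(2)]) (use pull_in_PiE[OF f(1) assms(5)] sq(2) in simp)
  then have "measure (prob_restrict X p\<^sub>1 P) {pull p\<^sub>1 (pull f \<gamma>)}
      = measure P {\<alpha> \<in> src f \<rightarrow>\<^sub>E X. pull p\<^sub>1 \<alpha> \<in> {pull p\<^sub>1 (pull f \<gamma>)}}"
    using measure_prob_restrict[OF p(1), of P "{pull p\<^sub>1 (pull f \<gamma>)}"] assms(4)
    unfolding sq(2) by blast
  then show ?thesis unfolding cylinder_eq_fst[OF assms(1)] singleton_iff .
qed

lemma measure_prob_restrict_pullback_snd:
  assumes "is_pullback FinSet f h p\<^sub>1 p\<^sub>2" "h \<in> Arr FinSet"
    and "f \<in> Arr FinSet" "Q \<in> config_measures X (src h)" "\<gamma> \<in> tgt h \<rightarrow>\<^sub>E X"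
  shows "measure (prob_restrict X p\<^sub>2 Q) {pull p\<^sub>2 (pull h \<gamma>)} = measure Q (cylinder X h f \<gamma>)"
proof -
  note sq = pullback_square[OF assms(1)]
  have h: "app h \<in> src h \<rightarrow>\<^sub>E tgt h" "finite (src h)" using assms(2) by simp_all
  have p: "p\<^sub>2 \<in> Arr FinSet" "app p\<^sub>2 \<in> src p\<^sub>2 \<rightarrow>\<^sub>E tgt p\<^sub>2" using sq h by simp_all
  have "pull p\<^sub>2 (pull h \<gamma>) \<in> src p\<^sub>2 \<rightarrow>\<^sub>E X"
    by (rule pull_in_PiE[OF p(2)]) (use pull_in_PiE[OF h(1) assms(5)] sq(3) in simp)
  then have "measure (prob_restrict X p\<^sub>2 Q) {pull p\<^sub>2 (pull h \<gamma>)}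
      = measure Q {\<beta> \<in> src h \<rightarrow>\<^sub>E X. pull p\<^sub>2 \<beta> \<in> {pull p\<^sub>2 (pull h \<gamma>)}}"
    using measure_prob_restrict[OF p(1), of Q "{pull p\<^sub>2 (pull h \<gamma>)}"] assms(4)
    unfolding sq(3) by blast
  then show ?thesis unfolding cylinder_eq_snd[OF assms(1)] singleton_iff .
qed

text \<open>
  This makes the gluing formula symmetric, and it is what carries a vanishing denominator over from
  one measure to the other.
\<close>

lemma compatible_cylinder:
  assumes cov: "(f, h) \<in> inj_bicoverings" and m: "compatible X f h P Q"
    and P: "P \<in> config_measures X (src f)" and Q: "Q \<in> config_measures X (src h)"
    and \<gamma>: "\<gamma> \<in> tgt f \<rightarrow>\<^sub>E X"
  shows "measure P (cylinder X f h \<gamma>) = measure Q (cylinder X h f \<gamma>)"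
proof -
  note pb = is_pullback_overlap_incl[OF cov] and arr = bicovering_arrows[OF cov]
  have \<gamma>': "\<gamma> \<in> tgt h \<rightarrow>\<^sub>E X" using \<gamma> inj_bicoveringsD(4)[OF cov] by simp
  show ?thesis
    using measure_prob_restrict_pullback[OF pb arr(2,1) P \<gamma>]
      measure_prob_restrict_pullback_snd[OF pb arr(2,1) Q \<gamma>'] m
    unfolding compatible_def pull_square[OF pb] by metis
qed

text \<open>
  The canonical overlap maps into any pullback by the universal property, so an equality of
  restrictions to that pullback restricts further, by functoriality, to the canonical overlap.
\<close>

lemma compatible_if_pullback:
  assumes cov: "(f, h) \<in> inj_bicoverings" and pb: "is_pullback FinSet f h p\<^sub>1 p\<^sub>2"
    and P: "P \<in> config_measures X (src f)" and Q: "Q \<in> config_measures X (src h)"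
    and eq: "prob_restrict X p\<^sub>1 P = prob_restrict X p\<^sub>2 Q"
  shows "compatible X f h P Q"
proof -
  note canon = is_pullback_overlap_incl[OF cov, unfolded is_pullback_def FinSet_simps(3,4)]
  note pb' = pb[unfolded is_pullback_def FinSet_simps(3,4)]
  let ?D = "src (overlap_incl f h)"
  have D: "?D \<in> Obj FinSet" using inj_bicoveringsD(1)[OF cov] by simp
  have cone: "overlap_incl f h \<in> Hom FinSet ?D (src f)" "overlap_incl h f \<in> Hom FinSet ?D (src h)"
    "Comp FinSet f (overlap_incl f h) = Comp FinSet h (overlap_incl h f)"
    using canon by - (elim conjE, assumption)+
  have p: "p\<^sub>1 \<in> Hom FinSet (src p\<^sub>1) (src f)" "p\<^sub>2 \<in> Hom FinSet (src p\<^sub>1) (src h)"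
    using pb' by - (elim conjE, assumption)+
  have "\<exists>!u. u \<in> Hom FinSet ?D (src p\<^sub>1) \<and> Comp FinSet p\<^sub>1 u = overlap_incl f h \<and>
      Comp FinSet p\<^sub>2 u = overlap_incl h f"
    using pb'[THEN conjunct2, THEN conjunct2, THEN conjunct2, THEN conjunct2, THEN conjunct2,
        THEN conjunct2, THEN bspec, OF D, THEN bspec, OF cone(1), THEN bspec, OF cone(2)] cone(3)
    by (rule mp)
  then obtain u where u: "u \<in> Hom FinSet ?D (src p\<^sub>1)" "Comp FinSet p\<^sub>1 u = overlap_incl f h"
    "Comp FinSet p\<^sub>2 u = overlap_incl h f" by (elim ex1E conjE)
  show ?thesis
    unfolding compatible_def u(2,3)[symmetric]
    using prob_restrict_Comp[OF u(1) p(1) P] prob_restrict_Comp[OF u(1) p(2) Q] eq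
    by (simp only:)
qed

text \<open>
  Two restrictions of the same measure agree on the overlap because the pullback square commutes.
\<close>

lemma compatible_restrict:
  assumes cov: "(f, h) \<in> inj_bicoverings" and R: "R \<in> config_measures X (tgt f)"
  shows "compatible X f h (prob_restrict X f R) (prob_restrict X h R)"
proof -
  let ?D = "src (overlap_incl f h)"
  note canon = is_pullback_overlap_incl[OF cov, unfolded is_pullback_def FinSet_simps(3,4)]
  have ov: "overlap_incl f h \<in> Hom FinSet ?D (src f)" "overlap_incl h f \<in> Hom FinSet ?D (src h)"
    "Comp FinSet f (overlap_incl f h) = Comp FinSet h (overlap_incl h f)"
    using canon by - (elim conjE, assumption)+
  have "f \<in> Hom FinSet (src f) (tgt f)" "h \<in> Hom FinSet (src h) (tgt f)"
    using inj_bicoveringsD[OF cov] by (simp_all add: in_Hom_FinSet_iff)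
  from prob_restrict_Comp[OF ov(1) this(1) R] prob_restrict_Comp[OF ov(2) this(2) R]
  show ?thesis unfolding compatible_def ov(3) by (rule trans[OF sym])
qed

section \<open>The glued measure\<close>

lemma prob_glue_config:
  assumes "finite (tgt f)"
  shows "prob_glue X f h P Q \<in> config_measures X (tgt f)"
  unfolding prob_glue_def by (rule point_measure_config[OF assms])

text \<open>
  The denominator of the gluing formula, an overlap marginal at a single point, is the mass of a
  cylinder.
\<close>

lemma measure_prob_glue:
  assumes cov: "(f, h) \<in> inj_bicoverings"
    and P: "P \<in> config_measures X (src f)" and \<gamma>: "\<gamma> \<in> tgt f \<rightarrow>\<^sub>E X"
  shows "measure (prob_glue X f h P Q) {\<gamma>} =
    measure P {pull f \<gamma>} * measure Q {pull h \<gamma>} / measure P (cylinder X f h \<gamma>)"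
proof -
  let ?D = "app f ` src f \<inter> app h ` src h"
  note pb = is_pullback_overlap_incl[OF cov] and arr = bicovering_arrows[OF cov]
  have "restrict \<gamma> ?D = pull (overlap_incl f h) (pull f \<gamma>)"
  proof
    show "restrict \<gamma> ?D c = pull (overlap_incl f h) (pull f \<gamma>) c" for c
      by (cases "c \<in> ?D") (auto simp: compose_def f_inv_into_f inv_into_into)
  qed
  then have "measure (prob_restrict X (overlap_incl f h) P) {restrict \<gamma> ?D}
      = measure P (cylinder X f h \<gamma>)"
    using measure_prob_restrict_pullback[OF pb arr(2,1) P \<gamma>] by metis
  then show ?thesis
    unfolding prob_glue_def
    by (subst measure_point_measure_config[OF inj_bicoveringsD(3)[OF cov] \<gamma>]) simp_all
qed

lemma prob_glue_commute:
  assumes cov: "(f, h) \<in> inj_bicoverings" and m: "compatible X f h P Q"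
    and P: "P \<in> config_measures X (src f)" and Q: "Q \<in> config_measures X (src h)"
  shows "prob_glue X h f Q P = prob_glue X f h P Q"
proof (rule config_measure_eqI)
  note fh = inj_bicoveringsD[OF cov]
  have cov': "(h, f) \<in> inj_bicoverings" using cov by (auto simp: inj_bicoverings_def)
  show "prob_glue X f h P Q \<in> config_measures X (tgt f)" by (rule prob_glue_config[OF fh(3)])
  show "prob_glue X h f Q P \<in> config_measures X (tgt f)"
    using prob_glue_config[of h f Q P] fh(3,4) by simp
  show "finite (tgt f)" by (rule fh(3))
  fix \<gamma> assume \<gamma>: "\<gamma> \<in> tgt f \<rightarrow>\<^sub>E X"
  then have \<gamma>': "\<gamma> \<in> tgt h \<rightarrow>\<^sub>E X" using fh(4) by simp
  show "measure (prob_glue X h f Q P) {\<gamma>} = measure (prob_glue X f h P Q) {\<gamma>}"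
    unfolding measure_prob_glue[OF cov P \<gamma>] measure_prob_glue[OF cov' Q \<gamma>']
      compatible_cylinder[OF cov m P Q \<gamma>] by simp
qed

text \<open>
  The overlap is all of \<open>src f\<close>, so the cylinder is a single point and the formula reads
  \<open>p * q / p\<close>. If \<open>p = 0\<close>, compatibility gives measure zero to a cylinder containing \<open>\<gamma>\<close>,
  hence \<open>q = 0\<close> as well.
\<close>

lemma prob_glue_Ident_right:
  assumes cov: "(f, Ident FinSet B) \<in> inj_bicoverings" and m: "compatible X f (Ident FinSet B) P Q"
    and P: "P \<in> config_measures X (src f)" and Q: "Q \<in> config_measures X B"
  shows "prob_glue X f (Ident FinSet B) P Q = Q"
proof (rule config_measure_eqI)
  let ?i = "Ident FinSet B"
  note fh = inj_bicoveringsD[OF cov]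
  have i: "src ?i = B" "tgt ?i = B" "app ?i ` src ?i = B" by simp_all
  have f: "tgt f = B" using fh(4) i by simp
  show "prob_glue X f ?i P Q \<in> config_measures X B"
    using prob_glue_config[of f ?i P Q] fh(3) f by simp
  show "Q \<in> config_measures X B" "finite B" using Q fh(3) f by simp_all
  fix \<gamma> assume \<gamma>: "\<gamma> \<in> B \<rightarrow>\<^sub>E X"
  then have \<gamma>': "\<gamma> \<in> tgt f \<rightarrow>\<^sub>E X" "\<gamma> \<in> tgt ?i \<rightarrow>\<^sub>E X" using f by simp_all
  have cyl: "cylinder X f ?i \<gamma> = {pull f \<gamma>}"
  proof (rule equalityI)
    show "{pull f \<gamma>} \<subseteq> cylinder X f ?i \<gamma>"
      using pull_in_cylinder[OF fh(5) \<gamma>'(1)] by blast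
    show "cylinder X f ?i \<gamma> \<subseteq> {pull f \<gamma>}"
    proof
      fix \<alpha> assume "\<alpha> \<in> cylinder X f ?i \<gamma>"
      then have \<alpha>: "\<alpha> \<in> src f \<rightarrow>\<^sub>E X" "\<And>a. a \<in> src f \<Longrightarrow> \<alpha> a = \<gamma> (app f a)"
        using fh(5) PiE_mem[OF fh(5)] unfolding cylinder_def i(3) f by simp_all
      have "\<alpha> = pull f \<gamma>"
        by (rule PiE_ext[OF \<alpha>(1) pull_in_PiE[OF fh(5) \<gamma>'(1)]]) (simp add: \<alpha>(2) compose_eq)
      then show "\<alpha> \<in> {pull f \<gamma>}" by simp
    qed
  qed
  have "measure Q {\<gamma>} = 0" if "measure P {pull f \<gamma>} = 0"
  proof (rule measure_config_zero_mono[OF Q])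
    show "cylinder X ?i f \<gamma> \<subseteq> B \<rightarrow>\<^sub>E X" using cylinder_subset[of X ?i f \<gamma>] i by simp
    show "measure Q (cylinder X ?i f \<gamma>) = 0"
      using compatible_cylinder[OF cov m P _ \<gamma>'(1)] Q i cyl that by simp
    show "\<gamma> \<in> cylinder X ?i f \<gamma>"
      using pull_in_cylinder[OF fh(6)[folded fh(4)] \<gamma>'(2)] pull_Ident[OF \<gamma>] by metis
  qed
  then show "measure (prob_glue X f ?i P Q) {\<gamma>} = measure Q {\<gamma>}"
    unfolding measure_prob_glue[OF cov P \<gamma>'(1)] cyl pull_Ident[OF \<gamma>] by simp
qed

section \<open>Partial naturality\<close>

text \<open>
  For fixed \<open>\<gamma>'\<close> let \<open>EA\<close>, \<open>EB\<close>, \<open>EC\<close> be the configurations on the objects of the target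
  bicovering whose pullbacks are the restrictions of \<open>\<gamma>'\<close>. Restriction to the legs is a bijection
  from \<open>EC\<close> to \<open>EA \<times> EB\<close>: surjectivity of \<open>q\<^sub>a\<close> on overlaps, with \<open>h\<close> injective,
  forces all members of \<open>EA\<close> and \<open>EB\<close> to agree there. For the same reason all members of \<open>EC\<close> have the same cylinder, whose mass \<open>K\<close>
  can be pulled out of the sum, a common factor \<open>1 / K\<close> even when \<open>K = 0\<close>.
\<close>

lemma prob_glue_natural:
  assumes cov': "(f', h') \<in> inj_bicoverings" and cov: "(f, h) \<in> inj_bicoverings"
    and qa: "q\<^sub>a \<in> Hom FinSet (src f') (src f)" and qb: "q\<^sub>b \<in> Hom FinSet (src h') (src h)"
    and qc: "q\<^sub>c \<in> Hom FinSet (tgt f') (tgt f)"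
    and comm: "Comp FinSet f q\<^sub>a = Comp FinSet q\<^sub>c f'" "Comp FinSet h q\<^sub>b = Comp FinSet q\<^sub>c h'"
    and onto: "\<And>a. a \<in> src f \<Longrightarrow> app f a \<in> app h ` src h \<Longrightarrow>
      \<exists>a'\<in>src f'. app f' a' \<in> app h' ` src h' \<and> app q\<^sub>a a' = a"
    and P: "P \<in> config_measures X (src f)" and Q: "Q \<in> config_measures X (src h)"
  shows "prob_restrict X q\<^sub>c (prob_glue X f h P Q) =
    prob_glue X f' h' (prob_restrict X q\<^sub>a P) (prob_restrict X q\<^sub>b Q)"
proof (rule config_measure_eqI)
  note fh = inj_bicoveringsD[OF cov] and fh' = inj_bicoveringsD[OF cov']
  have a: "src q\<^sub>a = src f'" "tgt q\<^sub>a = src f" "app q\<^sub>a \<in> src f' \<rightarrow>\<^sub>E src f" "q\<^sub>a \<in> Arr FinSet"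
    and b: "src q\<^sub>b = src h'" "tgt q\<^sub>b = src h" "app q\<^sub>b \<in> src h' \<rightarrow>\<^sub>E src h" "q\<^sub>b \<in> Arr FinSet"
    and c: "src q\<^sub>c = tgt f'" "tgt q\<^sub>c = tgt f" "app q\<^sub>c \<in> tgt f' \<rightarrow>\<^sub>E tgt f" "q\<^sub>c \<in> Arr FinSet"
    using qa qb qc by (simp_all add: in_Hom_FinSet_iff)
  have fa: "app f (app q\<^sub>a a') = app q\<^sub>c (app f' a')" if "a' \<in> src f'" for a'
    by (rule app_Comp_eqD[OF comm(1)]) (simp add: a that)
  have hb: "app h (app q\<^sub>b b') = app q\<^sub>c (app h' b')" if "b' \<in> src h'" for b'
    by (rule app_Comp_eqD[OF comm(2)]) (simp add: b that)
  have pull_f: "pull q\<^sub>a (pull f \<gamma>) = pull f' (pull q\<^sub>c \<gamma>)" for \<gamma> :: "_ \<Rightarrow> 'o"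
    using pull_Comp[of q\<^sub>a f \<gamma>] pull_Comp[of f' q\<^sub>c \<gamma>] a(1,3) c(1) fh'(5) comm(1) by metis
  have pull_h: "pull q\<^sub>b (pull h \<gamma>) = pull h' (pull q\<^sub>c \<gamma>)" for \<gamma> :: "_ \<Rightarrow> 'o"
    using pull_Comp[of q\<^sub>b h \<gamma>] pull_Comp[of h' q\<^sub>c \<gamma>] b(1,3) c(1) fh'(6) comm(2) by metis
  have R: "prob_glue X f h P Q \<in> config_measures X (tgt q\<^sub>c)"
    unfolding c(2) by (rule prob_glue_config[OF fh(3)])
  have Pa: "prob_restrict X q\<^sub>a P \<in> config_measures X (src f')"
    using prob_restrict_config[of q\<^sub>a P] a(1) fh'(1) by simp
  show "prob_restrict X q\<^sub>c (prob_glue X f h P Q) \<in> config_measures X (tgt f')"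
    using prob_restrict_config[of q\<^sub>c "prob_glue X f h P Q"] c(1) fh'(3) by simp
  show "prob_glue X f' h' (prob_restrict X q\<^sub>a P) (prob_restrict X q\<^sub>b Q) \<in> config_measures X (tgt f')"
    by (rule prob_glue_config[OF fh'(3)])
  show "finite (tgt f')" by (rule fh'(3))
  fix \<gamma>' assume \<gamma>': "\<gamma>' \<in> tgt f' \<rightarrow>\<^sub>E X"
  define EA where "EA = {\<alpha> \<in> src f \<rightarrow>\<^sub>E X. pull q\<^sub>a \<alpha> \<in> {pull f' \<gamma>'}}"
  define EB where "EB = {\<beta> \<in> src h \<rightarrow>\<^sub>E X. pull q\<^sub>b \<beta> \<in> {pull h' \<gamma>'}}"
  define EC where "EC = {\<gamma> \<in> tgt f \<rightarrow>\<^sub>E X. pull q\<^sub>c \<gamma> \<in> {\<gamma>'}}"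
  define K where "K = measure P {\<alpha> \<in> src f \<rightarrow>\<^sub>E X. pull q\<^sub>a \<alpha> \<in> cylinder X f' h' \<gamma>'}"
  have f'_in: "pull f' \<gamma>' \<in> src f' \<rightarrow>\<^sub>E X" by (rule pull_in_PiE[OF fh'(5) \<gamma>'])
  have h'_in: "pull h' \<gamma>' \<in> src h' \<rightarrow>\<^sub>E X"
    by (rule pull_in_PiE) (use fh'(4,6) \<gamma>' in simp_all)
  have mass_a: "measure (prob_restrict X q\<^sub>a P) {pull f' \<gamma>'} = measure P EA"
    unfolding EA_def using measure_prob_restrict[OF a(4), of P "{pull f' \<gamma>'}"] P f'_in
    unfolding a(1,2) by blast
  have mass_b: "measure (prob_restrict X q\<^sub>b Q) {pull h' \<gamma>'} = measure Q EB"
    unfolding EB_def using measure_prob_restrict[OF b(4), of Q "{pull h' \<gamma>'}"] Q h'_in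
    unfolding b(1,2) by blast
  have mass_c: "measure (prob_restrict X q\<^sub>c (prob_glue X f h P Q)) {\<gamma>'}
      = measure (prob_glue X f h P Q) EC"
    unfolding EC_def using measure_prob_restrict[OF c(4) R, of "{\<gamma>'}"] \<gamma>'
    unfolding c(1,2) by blast
  have mass_cyl: "measure (prob_restrict X q\<^sub>a P) (cylinder X f' h' \<gamma>') = K"
    unfolding K_def using measure_prob_restrict[OF a(4), of P "cylinder X f' h' \<gamma>'"] P
      cylinder_subset[of X f' h' \<gamma>'] unfolding a(1,2) by blast
  have EC_D: "\<gamma> \<in> tgt f \<rightarrow>\<^sub>E X" "pull q\<^sub>c \<gamma> = \<gamma>'" if "\<gamma> \<in> EC" for \<gamma>
    using that by (simp_all add: EC_def)
  have cyl: "cylinder X f h \<gamma> = {\<alpha> \<in> src f \<rightarrow>\<^sub>E X. pull q\<^sub>a \<alpha> \<in> cylinder X f' h' \<gamma>'}"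
    if "\<gamma> \<in> EC" for \<gamma>
  proof -
    have \<gamma>: "\<gamma>' (app f' a') = \<gamma> (app f (app q\<^sub>a a'))" if "a' \<in> src f'" for a'
      using EC_D(2)[OF \<open>\<gamma> \<in> EC\<close>] PiE_mem[OF fh'(5) that] fa[OF that] c(1) compose_eq by metis
    have "(\<forall>a\<in>src f. app f a \<in> app h ` src h \<longrightarrow> \<alpha> a = \<gamma> (app f a)) \<longleftrightarrow>
        (\<forall>a'\<in>src f'. app f' a' \<in> app h' ` src h' \<longrightarrow> \<alpha> (app q\<^sub>a a') = \<gamma>' (app f' a'))" for \<alpha>
    proof (intro iffI ballI impI)
      fix a' assume *: "\<forall>a\<in>src f. app f a \<in> app h ` src h \<longrightarrow> \<alpha> a = \<gamma> (app f a)"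
        "a' \<in> src f'" "app f' a' \<in> app h' ` src h'"
      from *(3) obtain b' where b': "b' \<in> src h'" "app f' a' = app h' b'" by (elim imageE)
      have "app f (app q\<^sub>a a') = app h (app q\<^sub>b b')"
        using fa[OF *(2)] hb[OF b'(1)] b'(2) by simp
      then have "app f (app q\<^sub>a a') \<in> app h ` src h" using PiE_mem[OF b(3) b'(1)] by simp
      then show "\<alpha> (app q\<^sub>a a') = \<gamma>' (app f' a')"
        using *(1) PiE_mem[OF a(3) *(2)] \<gamma>[OF *(2)] by simp
    next
      fix a assume *: "\<forall>a'\<in>src f'. app f' a' \<in> app h' ` src h' \<longrightarrow> \<alpha> (app q\<^sub>a a') = \<gamma>' (app f' a')"
        "a \<in> src f" "app f a \<in> app h ` src h"
      from onto[OF *(2,3)] obtain a' where a': "a' \<in> src f'" "app f' a' \<in> app h' ` src h'"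
        "app q\<^sub>a a' = a" by (elim bexE conjE)
      then show "\<alpha> a = \<gamma> (app f a)" using *(1) \<gamma>[OF a'(1)] by metis
    qed
    moreover have "pull q\<^sub>a \<alpha> \<in> src f' \<rightarrow>\<^sub>E X" if "\<alpha> \<in> src f \<rightarrow>\<^sub>E X" for \<alpha>
      using compose_in_PiE[OF a(3) that] a(1) by simp
    ultimately show ?thesis
      unfolding cylinder_def by (intro Collect_cong conj_cong refl) (simp add: a(1) compose_eq)
  qed
  have bij: "bij_betw (\<lambda>\<gamma>. (pull f \<gamma>, pull h \<gamma>)) EC (EA \<times> EB)"
  proof (rule bij_betwI')
    fix \<gamma> \<delta> assume "\<gamma> \<in> EC" "\<delta> \<in> EC"
    then show "((pull f \<gamma>, pull h \<gamma>) = (pull f \<delta>, pull h \<delta>)) = (\<gamma> = \<delta>)"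
      using bicovering_config_eqI[OF cov EC_D(1) EC_D(1)] by (metis prod.inject)
  next
    fix \<gamma> assume "\<gamma> \<in> EC"
    then have \<gamma>: "\<gamma> \<in> tgt f \<rightarrow>\<^sub>E X" "\<gamma> \<in> tgt h \<rightarrow>\<^sub>E X" "pull q\<^sub>c \<gamma> = \<gamma>'" using EC_D fh(4) by simp_all
    have "pull f \<gamma> \<in> EA"
      using pull_in_PiE[OF fh(5) \<gamma>(1)] pull_f[of \<gamma>] \<gamma>(3) unfolding EA_def by simp
    moreover have "pull h \<gamma> \<in> EB"
      using pull_in_PiE[OF fh(6)[folded fh(4)] \<gamma>(2)] pull_h[of \<gamma>] \<gamma>(3) unfolding EB_def by simp
    ultimately show "(pull f \<gamma>, pull h \<gamma>) \<in> EA \<times> EB" by simp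
  next
    fix y assume "y \<in> EA \<times> EB"
    then obtain \<alpha> \<beta> where y: "y = (\<alpha>, \<beta>)" and \<alpha>: "\<alpha> \<in> src f \<rightarrow>\<^sub>E X" "pull q\<^sub>a \<alpha> = pull f' \<gamma>'"
      and \<beta>: "\<beta> \<in> src h \<rightarrow>\<^sub>E X" "pull q\<^sub>b \<beta> = pull h' \<gamma>'"
      by (auto simp: EA_def EB_def)
    have \<alpha>': "\<alpha> (app q\<^sub>a a') = \<gamma>' (app f' a')" if "a' \<in> src f'" for a'
      using fun_cong[OF \<alpha>(2), of a'] that a(1) by (simp add: compose_eq)
    have \<beta>': "\<beta> (app q\<^sub>b b') = \<gamma>' (app h' b')" if "b' \<in> src h'" for b'
      using fun_cong[OF \<beta>(2), of b'] that b(1) by (simp add: compose_eq)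
    have "\<alpha> u = \<beta> v" if uv: "u \<in> src f" "v \<in> src h" "app f u = app h v" for u v
    proof -
      have "app f u \<in> app h ` src h" using uv by simp
      from onto[OF uv(1) this] obtain a' where a': "a' \<in> src f'"
        "app f' a' \<in> app h' ` src h'" "app q\<^sub>a a' = u" by (elim bexE conjE)
      from a'(2) obtain b' where b': "b' \<in> src h'" "app f' a' = app h' b'" by (elim imageE)
      have "app h (app q\<^sub>b b') = app h v"
        using hb[OF b'(1)] fa[OF a'(1)] b'(2) a'(3) uv(3) by simp
      then have "app q\<^sub>b b' = v"
        by (rule inj_onD[OF fh(8) _ PiE_mem[OF b(3) b'(1)] uv(2)])
      then show ?thesis using \<alpha>'[OF a'(1)] \<beta>'[OF b'(1)] a'(3) b'(2) by simp
    qed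
    then have "\<forall>u\<in>src f. \<forall>v\<in>src h. app f u = app h v \<longrightarrow> \<alpha> u = \<beta> v" by simp
    then obtain \<gamma> where \<gamma>: "\<gamma> \<in> tgt f \<rightarrow>\<^sub>E X" "pull f \<gamma> = \<alpha>" "pull h \<gamma> = \<beta>"
      by (rule amalgamate_configs[OF cov \<alpha>(1) \<beta>(1)])
    have "pull q\<^sub>c \<gamma> = \<gamma>'"
    proof (rule bicovering_config_eqI[OF cov' _ \<gamma>'])
      show "pull q\<^sub>c \<gamma> \<in> tgt f' \<rightarrow>\<^sub>E X" using compose_in_PiE[OF c(3) \<gamma>(1)] c(1) by simp
      show "pull f' (pull q\<^sub>c \<gamma>) = pull f' \<gamma>'" using pull_f[of \<gamma>] \<gamma>(2) \<alpha>(2) by simp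
      show "pull h' (pull q\<^sub>c \<gamma>) = pull h' \<gamma>'" using pull_h[of \<gamma>] \<gamma>(3) \<beta>(2) by simp
    qed
    then show "\<exists>\<gamma>\<in>EC. y = (pull f \<gamma>, pull h \<gamma>)"
      using \<gamma> y by (intro bexI[of _ \<gamma>]) (simp_all add: EC_def)
  qed
  have "measure (prob_glue X f h P Q) EC = (\<Sum>\<gamma>\<in>EC. measure (prob_glue X f h P Q) {\<gamma>})"
    by (rule measure_config_eq_sum[OF R]) (use fh(3) c(2) EC_def in auto)
  also have "\<dots> = (\<Sum>\<gamma>\<in>EC. measure P {pull f \<gamma>} * measure Q {pull h \<gamma>} / K)"
  proof (rule sum.cong[OF refl])
    fix \<gamma> assume \<gamma>: "\<gamma> \<in> EC"
    show "measure (prob_glue X f h P Q) {\<gamma>} = measure P {pull f \<gamma>} * measure Q {pull h \<gamma>} / K"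
      unfolding measure_prob_glue[OF cov P EC_D(1)[OF \<gamma>]] cyl[OF \<gamma>] K_def ..
  qed
  also have "\<dots> = (\<Sum>(\<alpha>, \<beta>)\<in>EA \<times> EB. measure P {\<alpha>} * measure Q {\<beta>} / K)"
    using sum.reindex_bij_betw[OF bij, of "\<lambda>(\<alpha>, \<beta>). measure P {\<alpha>} * measure Q {\<beta>} / K"] by simp
  also have "\<dots> = (\<Sum>\<alpha>\<in>EA. measure P {\<alpha>}) * (\<Sum>\<beta>\<in>EB. measure Q {\<beta>}) / K"
    by (simp add: sum_product sum.cartesian_product sum_divide_distrib case_prod_unfold)
  also have "(\<Sum>\<alpha>\<in>EA. measure P {\<alpha>}) = measure P EA"
    by (rule measure_config_eq_sum[OF P fh(1), symmetric]) (simp add: EA_def)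
  also have "(\<Sum>\<beta>\<in>EB. measure Q {\<beta>}) = measure Q EB"
    by (rule measure_config_eq_sum[OF Q fh(2), symmetric]) (simp add: EB_def)
  finally show "measure (prob_restrict X q\<^sub>c (prob_glue X f h P Q)) {\<gamma>'} =
      measure (prob_glue X f' h' (prob_restrict X q\<^sub>a P) (prob_restrict X q\<^sub>b Q)) {\<gamma>'}"
    unfolding measure_prob_glue[OF cov' Pa \<gamma>'] mass_a mass_b mass_c mass_cyl .
qed

section \<open>Marginals of the glued measure\<close>

text \<open>
  The inclusion of the overlap into \<open>src f\<close>, the identity of \<open>src h\<close> and \<open>h\<close> itself form a
  morphism to \<open>(f, h)\<close> from a bicovering with an identity leg, and on overlaps this morphism is
  bijective. Naturality thus reduces the marginal to a gluing along an identity.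
\<close>

lemma prob_restrict_prob_glue_snd:
  assumes cov: "(f, h) \<in> inj_bicoverings" and m: "compatible X f h P Q"
    and P: "P \<in> config_measures X (src f)" and Q: "Q \<in> config_measures X (src h)"
  shows "prob_restrict X h (prob_glue X f h P Q) = Q"
proof -
  note fh = inj_bicoveringsD[OF cov]
  let ?i = "Ident FinSet (src h)" and ?p = "overlap_incl f h" and ?q = "overlap_incl h f"
  have i: "src ?i = src h" "tgt ?i = src h" "app ?i ` src ?i = src h" by simp_all
  note canon = is_pullback_overlap_incl[OF cov, unfolded is_pullback_def FinSet_simps(3,4)]
  have ov: "?p \<in> Hom FinSet (src ?p) (src f)"
    "Comp FinSet f ?p = Comp FinSet h ?q"
    using canon by - (elim conjE, assumption)+
  have src: "src ?p = src ?q" by (simp add: Int_commute)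
  have q_in: "app ?q \<in> src ?q \<rightarrow>\<^sub>E src h"
    using overlap_incl_in_PiE[of h f] by simp
  have cov': "(?q, ?i) \<in> inj_bicoverings"
  proof -
    have "inj_on (app ?q) (src ?q)"
    proof (rule inj_onI)
      fix c d assume "c \<in> src ?q" "d \<in> src ?q" "app ?q c = app ?q d"
      then have "inv_into (src h) (app h) c = inv_into (src h) (app h) d"
        "c \<in> app h ` src h" "d \<in> app h ` src h" by simp_all
      then show "c = d" by (rule inv_into_injective)
    qed
    moreover have "app ?q ` src ?q \<union> app ?i ` src ?i = src h"
      unfolding i(3) by (rule Un_absorb1) (intro image_subsetI PiE_mem[OF q_in])
    moreover have "?q \<in> Arr FinSet" "?i \<in> Arr FinSet" "tgt ?q = tgt ?i" "inj_on (app ?i) (src ?i)"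
      using q_in fh(1,2) by (simp_all add: inj_on_def)
    ultimately show ?thesis
      unfolding inj_bicoverings_def mem_Collect_eq prod.case overlap_incl_simps(2) by blast
  qed
  have Qi: "prob_restrict X ?i Q = Q" by (rule prob_restrict_Ident[OF fh(2) Q])
  have R: "prob_restrict X ?q Q \<in> config_measures X (src ?q)"
    using prob_restrict_config[of ?q Q] fh(1) by simp
  have compat': "compatible X ?q ?i (prob_restrict X ?q Q) Q"
    using compatible_restrict[OF cov', of Q] Q Qi by simp
  have "prob_restrict X h (prob_glue X f h P Q)
      = prob_glue X ?q ?i (prob_restrict X ?p P) (prob_restrict X ?i Q)"
  proof (rule prob_glue_natural[OF cov' cov _ _ _ ov(2) refl _ P Q])
    show "?p \<in> Hom FinSet (src ?q) (src f)" using ov(1) src by simp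
    show "?i \<in> Hom FinSet (src ?i) (src h)" using fh(2) by (simp add: in_Hom_FinSet_iff)
    show "h \<in> Hom FinSet (tgt ?q) (tgt f)" using fh by (simp add: in_Hom_FinSet_iff)
    show "\<exists>c\<in>src ?q. app ?q c \<in> app ?i ` src ?i \<and> app ?p c = a"
      if "a \<in> src f" "app f a \<in> app h ` src h" for a
    proof (intro bexI conjI)
      show D: "app f a \<in> src ?q" using that by simp
      show "app ?q (app f a) \<in> app ?i ` src ?i" unfolding i(3) by (rule PiE_mem[OF q_in D])
      show "app ?p (app f a) = a" using that fh(7) by (simp add: inv_into_f_f)
    qed
  qed
  also have "\<dots> = prob_glue X ?q ?i (prob_restrict X ?q Q) Q"
    using m unfolding Qi compatible_def by simp
  also have "\<dots> = Q"
    by (rule prob_glue_Ident_right[OF cov' compat' R Q])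
  finally show ?thesis .
qed

text \<open>
  The marginal on \<open>src h\<close> has total mass 1, and restriction preserves total mass.
\<close>

lemma prob_glue_prob:
  assumes cov: "(f, h) \<in> inj_bicoverings" and m: "compatible X f h P Q"
    and P: "P \<in> prob_measures X (src f)" and Q: "Q \<in> prob_measures X (src h)"
  shows "prob_glue X f h P Q \<in> prob_measures X (tgt f)"
proof -
  have P': "P \<in> config_measures X (src f)" and Q': "Q \<in> config_measures X (src h)"
    using P Q prob_measures_subset by blast+
  have t: "tgt h = tgt f" by (rule inj_bicoveringsD(4)[OF cov])
  have "prob_glue X f h P Q \<in> config_measures X (tgt h)"
    unfolding t by (rule prob_glue_config[OF inj_bicoveringsD(3)[OF cov]])
  from prob_restrict_prob_iff[OF bicovering_arrows(2)[OF cov] this]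
  show ?thesis unfolding prob_restrict_prob_glue_snd[OF cov m P' Q'] t using Q by simp
qed

text \<open>
  By naturality along the identity of \<open>src k\<close>, \<open>p\<^sub>2\<close> and \<open>f\<close>, the restriction of \<open>R\<close> along \<open>f\<close> is
  the gluing of \<open>P\<close> with the overlap marginal of \<open>Q\<close>. Writing \<open>p\<close>, \<open>q\<close> for the point masses,
  \<open>r\<close> for the mass of the cylinder over \<open>src k\<close> and \<open>c\<close> for that of the cylinder over \<open>src h\<close>, the
  second gluing has mass \<open>(p * c / r) * q / c\<close>, which is the mass \<open>p * q / r\<close> of \<open>R\<close>; if \<open>c = 0\<close>
  then \<open>q = 0\<close>.
\<close>

lemma prob_glue_back_and_forth:
  assumes cov: "(f, h) \<in> inj_bicoverings" and pb: "is_pullback FinSet f h p\<^sub>1 p\<^sub>2"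
    and k: "(k, p\<^sub>1) \<in> inj_bicoverings" and m: "compatible X (Comp FinSet f k) h P Q"
    and P: "P \<in> config_measures X (src k)" and Q: "Q \<in> config_measures X (src h)"
  defines "R \<equiv> prob_glue X (Comp FinSet f k) h P Q"
  shows "prob_glue X f h (prob_restrict X f R) (prob_restrict X h R) = R"
proof (rule config_measure_eqI)
  note fh = inj_bicoveringsD[OF cov] and kp = inj_bicoveringsD[OF k]
    and sq = pullback_square[OF pb]
  let ?fk = "Comp FinSet f k"
  have cov_fk: "(?fk, h) \<in> inj_bicoverings"
    by (rule bicovering_system.cov_comp[OF bicovering_system_FinSet cov pb k])
  have fk: "src ?fk = src k" "tgt ?fk = tgt f" by simp_all
  have tk: "tgt k = src f" using kp(4) sq(2) by simp
  have P': "P \<in> config_measures X (src ?fk)" using P by simp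
  have R: "R \<in> config_measures X (tgt f)"
    using prob_glue_config[of ?fk h P Q] fh(3) by (simp add: R_def)
  have Rf: "prob_restrict X f R \<in> config_measures X (src f)"
    by (rule prob_restrict_config[OF fh(1)])
  have Rh: "prob_restrict X h R = Q"
    unfolding R_def by (rule prob_restrict_prob_glue_snd[OF cov_fk m P' Q])
  define Q' where "Q' = prob_restrict X p\<^sub>2 Q"
  have Rf_eq: "prob_restrict X f R = prob_glue X k p\<^sub>1 P Q'"
  proof -
    have i: "prob_restrict X (Ident FinSet (src k)) P = P"
      by (rule prob_restrict_Ident[OF kp(1) P])
    have "k \<in> Hom FinSet (src k) (src f)" "f \<in> Hom FinSet (src f) (tgt f)"
      "?fk \<in> Hom FinSet (src k) (tgt f)"
      using kp fh inj_bicoveringsD[OF cov_fk] tk by (simp_all add: in_Hom_FinSet_iff)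
    note homs = this
    have "prob_restrict X f R = prob_glue X k p\<^sub>1 (prob_restrict X (Ident FinSet (src k)) P) Q'"
      unfolding R_def Q'_def
    proof (rule prob_glue_natural[OF k cov_fk _ _ _ _ _ _ P' Q])
      show "Ident FinSet (src k) \<in> Hom FinSet (src k) (src ?fk)"
        using kp(1) by (simp add: in_Hom_FinSet_iff)
      show "p\<^sub>2 \<in> Hom FinSet (src p\<^sub>1) (src h)"
        using sq fh(2) by (simp add: in_Hom_FinSet_iff)
      show "f \<in> Hom FinSet (tgt k) (tgt ?fk)" using homs(2) tk by simp
      show "Comp FinSet ?fk (Ident FinSet (src k)) = ?fk"
        by (rule category.Comp_Ident_right[OF category_FinSet homs(3)])
      show "Comp FinSet h p\<^sub>2 = Comp FinSet f p\<^sub>1"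
        using pb unfolding is_pullback_def by - (elim conjE, erule sym)
      fix a assume a: "a \<in> src ?fk" "app ?fk a \<in> app h ` src h"
      then have ak: "a \<in> src k" "app f (app k a) \<in> app h ` src h" by (simp_all add: compose_eq)
      then have "app k a \<in> app p\<^sub>1 ` src p\<^sub>1"
        using pullback_image(1)[OF pb] PiE_mem[OF kp(5)] tk by simp
      then show "\<exists>a'\<in>src k. app k a' \<in> app p\<^sub>1 ` src p\<^sub>1 \<and> app (Ident FinSet (src k)) a' = a"
        using ak(1) by (intro bexI[of _ a]) simp_all
    qed
    then show ?thesis unfolding i .
  qed
  have compat_R: "compatible X f h (prob_restrict X f R) Q"
    using compatible_restrict[OF cov R] unfolding Rh .
  show "prob_glue X f h (prob_restrict X f R) (prob_restrict X h R) \<in> config_measures X (tgt f)"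
    by (rule prob_glue_config[OF fh(3)])
  show "R \<in> config_measures X (tgt f)" "finite (tgt f)" by (fact R, fact fh(3))
  fix \<gamma> assume \<gamma>: "\<gamma> \<in> tgt f \<rightarrow>\<^sub>E X"
  have \<gamma>h: "\<gamma> \<in> tgt h \<rightarrow>\<^sub>E X" and \<gamma>fk: "\<gamma> \<in> tgt ?fk \<rightarrow>\<^sub>E X" using \<gamma> fh(4) by simp_all
  have \<gamma>f: "pull f \<gamma> \<in> tgt k \<rightarrow>\<^sub>E X" using pull_in_PiE[OF fh(5) \<gamma>] tk by simp
  \<comment> \<open>The overlap of \<open>k\<close> with \<open>p\<^sub>1\<close> is the overlap of the composed leg with \<open>h\<close>.\<close>
  have cyl: "cylinder X k p\<^sub>1 (pull f \<gamma>) = cylinder X ?fk h \<gamma>"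
    unfolding cylinder_def fk pullback_image(1)[OF pb]
    using PiE_mem[OF kp(5)] tk by (intro Collect_cong conj_cong refl ball_cong) (simp add: compose_eq)
  have Q': "measure Q' {pull p\<^sub>1 (pull f \<gamma>)} = measure Q (cylinder X h f \<gamma>)"
    unfolding Q'_def pull_square[OF pb]
    by (rule measure_prob_restrict_pullback_snd[OF pb bicovering_arrows(2,1)[OF cov] Q \<gamma>h])
  have pull_fk: "pull ?fk \<gamma> = pull k (pull f \<gamma>)"
    by (rule pull_Comp[OF kp(5)[unfolded tk]])
  have mass_Rf: "measure (prob_restrict X f R) {pull f \<gamma>} =
      measure P {pull k (pull f \<gamma>)} * measure Q (cylinder X h f \<gamma>) / measure P (cylinder X ?fk h \<gamma>)"
    unfolding Rf_eq measure_prob_glue[OF k P \<gamma>f] cyl Q' ..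
  have mass_R: "measure R {\<gamma>} =
      measure P {pull k (pull f \<gamma>)} * measure Q {pull h \<gamma>} / measure P (cylinder X ?fk h \<gamma>)"
    unfolding R_def measure_prob_glue[OF cov_fk P' \<gamma>fk] pull_fk ..
  have "measure Q {pull h \<gamma>} = 0" if "measure Q (cylinder X h f \<gamma>) = 0"
    by (rule measure_config_zero_mono[OF Q cylinder_subset that])
      (rule pull_in_cylinder[OF fh(6)[folded fh(4)] \<gamma>h])
  then show "measure (prob_glue X f h (prob_restrict X f R) (prob_restrict X h R)) {\<gamma>} = measure R {\<gamma>}"
    unfolding measure_prob_glue[OF cov Rf \<gamma>] Rh compatible_cylinder[OF cov compat_R Rf Q \<gamma>]
      mass_Rf mass_R by simp
qed

end

section \<open>Probability measures form a gleaf\<close>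

theorem proposition5p2p1:
  fixes X :: "'o set"
  assumes "finite X"
  shows "gleaf (FinSet :: ('a set, 'a fun_arrow) cat) inj_bicoverings
           (prob_measures X) (prob_restrict X) (prob_glue X)"
proof -
  interpret bicovering_system "FinSet :: ('a set, 'a fun_arrow) cat" inj_bicoverings
    by (rule bicovering_system_FinSet)
  interpret presheaf "FinSet :: ('a set, 'a fun_arrow) cat" "prob_measures X" "prob_restrict X"
    by (rule presheaf_prob_measures[OF assms])
  have matchD: "P \<in> prob_measures X (src f)" "Q \<in> prob_measures X (src h)"
      "P \<in> config_measures X (src f)" "Q \<in> config_measures X (src h)" "compatible X f h P Q"
    if "(f, h) \<in> inj_bicoverings" "is_pullback FinSet f h p\<^sub>1 p\<^sub>2"
      "(P, Q) \<in> matching FinSet (prob_measures X) (prob_restrict X) p\<^sub>1 p\<^sub>2"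
    for f h p\<^sub>1 p\<^sub>2 :: "'a fun_arrow" and P Q
  proof -
    show P: "P \<in> prob_measures X (src f)" and Q: "Q \<in> prob_measures X (src h)"
      using that(3) pullback_square(2,3)[OF that(2)] by (simp_all add: matching_def)
    then show P': "P \<in> config_measures X (src f)" and Q': "Q \<in> config_measures X (src h)"
      using prob_measures_subset by blast+
    show "compatible X f h P Q"
      by (rule compatible_if_pullback[OF assms that(1,2) P' Q'])
        (use that(3) in \<open>simp add: matching_def\<close>)
  qed
  show ?thesis
  proof
    fix f h p\<^sub>1 p\<^sub>2 :: "'a fun_arrow" and P Q
    assume cov: "(f, h) \<in> inj_bicoverings" and pb: "is_pullback FinSet f h p\<^sub>1 p\<^sub>2"
      and PQ: "(P, Q) \<in> matching FinSet (prob_measures X) (prob_restrict X) p\<^sub>1 p\<^sub>2"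
    note m = matchD[OF cov pb PQ]
    show "prob_glue X f h P Q \<in> prob_measures X (Cod FinSet f)"
      unfolding FinSet_simps(4) by (rule prob_glue_prob[OF assms cov m(5,1,2)])
    show "prob_glue X h f Q P = prob_glue X f h P Q"
      by (rule prob_glue_commute[OF assms cov m(5,3,4)])
  next
    fix A and h p\<^sub>1 p\<^sub>2 :: "'a fun_arrow" and P Q
    assume cov: "(Ident FinSet A, h) \<in> inj_bicoverings"
      and pb: "is_pullback FinSet (Ident FinSet A) h p\<^sub>1 p\<^sub>2"
      and PQ: "(P, Q) \<in> matching FinSet (prob_measures X) (prob_restrict X) p\<^sub>1 p\<^sub>2"
    note m = matchD[OF cov pb PQ]
    have P: "P \<in> config_measures X A" using m(3) by simp
    have sym: "compatible X h (Ident FinSet A) Q P"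
      using m(5) unfolding compatible_def by (rule sym)
    show "prob_glue X (Ident FinSet A) h P Q = P"
      unfolding prob_glue_commute[OF assms cov m(5,3,4), symmetric]
      by (rule prob_glue_Ident_right[OF assms cov_swap[OF cov] sym m(4) P])
  next
    fix B and f p\<^sub>1 p\<^sub>2 :: "'a fun_arrow" and P Q
    assume cov: "(f, Ident FinSet B) \<in> inj_bicoverings"
      and pb: "is_pullback FinSet f (Ident FinSet B) p\<^sub>1 p\<^sub>2"
      and PQ: "(P, Q) \<in> matching FinSet (prob_measures X) (prob_restrict X) p\<^sub>1 p\<^sub>2"
    note m = matchD[OF cov pb PQ]
    have Q: "Q \<in> config_measures X B" using m(4) by simp
    show "prob_glue X f (Ident FinSet B) P Q = Q"
      by (rule prob_glue_Ident_right[OF assms cov m(5,3) Q])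
  next
    fix f h p\<^sub>1 p\<^sub>2 k r\<^sub>1 r\<^sub>2 :: "'a fun_arrow" and P Q
    assume cov: "(f, h) \<in> inj_bicoverings" and pb: "is_pullback FinSet f h p\<^sub>1 p\<^sub>2"
      and k: "(k, p\<^sub>1) \<in> inj_bicoverings"
      and pb': "is_pullback FinSet (Comp FinSet f k) h r\<^sub>1 r\<^sub>2"
      and PQ: "(P, Q) \<in> matching FinSet (prob_measures X) (prob_restrict X) r\<^sub>1 r\<^sub>2"
    note m = matchD[OF cov_comp[OF cov pb k] pb' PQ]
    have P: "P \<in> config_measures X (src k)" using m(3) by simp
    show "prob_glue X f h (prob_restrict X f (prob_glue X (Comp FinSet f k) h P Q))
        (prob_restrict X h (prob_glue X (Comp FinSet f k) h P Q))
        = prob_glue X (Comp FinSet f k) h P Q"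
      by (rule prob_glue_back_and_forth[OF assms cov pb k m(5) P m(4)])
  next
    fix f' h' f h q\<^sub>a q\<^sub>b q\<^sub>c p\<^sub>1 p\<^sub>2 :: "'a fun_arrow" and P Q
    assume cov': "(f', h') \<in> inj_bicoverings" and cov: "(f, h) \<in> inj_bicoverings"
      and mor: "bicovering_morphism FinSet (f', h') (f, h) q\<^sub>a q\<^sub>b q\<^sub>c"
      and pb: "is_pullback FinSet f h p\<^sub>1 p\<^sub>2"
      and PQ: "(P, Q) \<in> matching FinSet (prob_measures X) (prob_restrict X) p\<^sub>1 p\<^sub>2"
    note m = matchD[OF cov pb PQ]
    have q: "q\<^sub>a \<in> Hom FinSet (src f') (src f)" "q\<^sub>b \<in> Hom FinSet (src h') (src h)"
      "q\<^sub>c \<in> Hom FinSet (tgt f') (tgt f)" "Comp FinSet f q\<^sub>a = Comp FinSet q\<^sub>c f'"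
      "Comp FinSet h q\<^sub>b = Comp FinSet q\<^sub>c h'"
      using mor unfolding bicovering_morphism_def prod.case FinSet_simps(3,4)
      by - (elim conjE, assumption)+
    show "prob_restrict X q\<^sub>c (prob_glue X f h P Q) =
        prob_glue X f' h' (prob_restrict X q\<^sub>a P) (prob_restrict X q\<^sub>b Q)"
      by (rule prob_glue_natural[OF assms cov' cov q bicovering_morphism_overlap[OF mor] m(3,4)])
  qed
qed

end
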